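(* Let $R$ be a complete discrete valuation ring whose residue field is finite of odd cardinality $q$, with fraction field $K$ of characteristic different from $2$. Let $f$ be a nondegenerate $n$-ary quadratic form over $R$ that is anisotropic and ADC. (a) If $n=2$, then $\delta_v(f)\in\{\frac{q}{q+1},\frac12,\frac{1}{q+1}\}$, and each of these values occurs. (b) If $n=3$, then $\delta_v(f)\in\{\frac{q+2}{2q+2},\frac{2q+1}{2q+2}\}$, and both values occur. (c) If $n\geq 4$, then $\delta_v(f)=1$.
   Context: $f$ over $R$ is ADC if every $x\in R$ of the form $f(w)$ with $w\in K^n$ is of the form $f(w')$ with $w'\in R^n$. $D_f\coloneqq f(R^n)\setminus\{0\}$; $\mu$ is the Haar measure on $R$ with $\mu(R)=1$; $\delta_v(f)\coloneqq\mu(D_f)$. "Occurs" means there is an anisotropic ADC form over $R$ of the given number of variables with that value. *)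

theory Defs
  imports
    "HOL-Analysis.Analysis"
    "HOL-Computational_Algebra.Computational_Algebra"
begin

section \<open>Complete discrete valuation rings\<close>

text \<open>
  A commutative ring is a module over itself; its submodules are the ideals and
  \<open>module.span (*)\<close> is the ideal generated by a set.
\<close>

definition ring_ideal :: "'r::comm_ring_1 set \<Rightarrow> bool" where
  "ring_ideal I \<longleftrightarrow> module.subspace (*) I"

definition maximal_ring_ideal :: "'r::comm_ring_1 set \<Rightarrow> bool" where
  "maximal_ring_ideal I \<longleftrightarrow> ring_ideal I \<and> I \<noteq> UNIV \<and>
     (\<forall>J. ring_ideal J \<and> I \<subseteq> J \<longrightarrow> J = I \<or> J = UNIV)"

fun ideal_power :: "'r::comm_ring_1 set \<Rightarrow> nat \<Rightarrow> 'r set" where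
  "ideal_power I 0 = UNIV"
| "ideal_power I (Suc k) = module.span (*) {x * y | x y. x \<in> I \<and> y \<in> ideal_power I k}"

text \<open>
  The ring is the whole type \<open>'r\<close>: a principal ideal domain, not a field, whose only
  maximal ideal is \<open>\<mm>\<close>.
\<close>

locale discrete_valuation_ring =
  fixes \<mm> :: "'r::idom set"
  assumes principal: "\<And>I :: 'r set. ring_ideal I \<Longrightarrow> \<exists>a. I = module.span (*) {a}"
    and maximal: "maximal_ring_ideal \<mm>"
    and local: "\<And>I :: 'r set. maximal_ring_ideal I \<Longrightarrow> I = \<mm>"
    and not_field: "\<mm> \<noteq> {0}"

text \<open>
  Completeness is convergence of all Cauchy sequences of the \<open>\<mm>\<close>-adic topology; in a
  discrete valuation ring this topology is automatically Hausdorff.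
\<close>

locale complete_discrete_valuation_ring = discrete_valuation_ring \<mm>
  for \<mm> :: "'r::idom set" +
  assumes complete: "\<And>x :: nat \<Rightarrow> 'r.
      (\<forall>k. \<exists>N. \<forall>i\<ge>N. \<forall>j\<ge>N. x i - x j \<in> ideal_power \<mm> k) \<Longrightarrow>
      (\<exists>l. \<forall>k. \<exists>N. \<forall>i\<ge>N. x i - l \<in> ideal_power \<mm> k)"

definition residue_field :: "'r::comm_ring_1 set \<Rightarrow> 'r set set" where
  "residue_field \<mm> = UNIV // {(x, y). x - y \<in> \<mm>}"

section \<open>Normalised Haar measure\<close>

definition adic_open :: "'r::comm_ring_1 set \<Rightarrow> 'r set \<Rightarrow> bool" where
  "adic_open \<mm> U \<longleftrightarrow> (\<forall>x\<in>U. \<exists>k. \<forall>y. y - x \<in> ideal_power \<mm> k \<longrightarrow> y \<in> U)"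

text \<open>
  Regularity is not listed among the conditions: for a finite residue field the additive
  group is compact and metrisable, so every finite Borel measure on it is regular.
\<close>

definition normalised_haar_measure :: "'r::comm_ring_1 set \<Rightarrow> 'r measure \<Rightarrow> bool" where
  "normalised_haar_measure \<mm> \<mu> \<longleftrightarrow>
     space \<mu> = UNIV \<and>
     sets \<mu> = sigma_sets UNIV {U. adic_open \<mm> U} \<and>
     (\<forall>A\<in>sets \<mu>. \<forall>x. emeasure \<mu> ((\<lambda>y. x + y) ` A) = emeasure \<mu> A) \<and>
     emeasure \<mu> UNIV = 1"

section \<open>Quadratic forms\<close>

text \<open>
  A family \<open>a :: nat \<Rightarrow> nat \<Rightarrow> 'r\<close> stands for the \<open>n\<close>-ary form
  \<open>\<Sum>\<^sub>i\<^sub>\<le>\<^sub>j a\<^sub>i\<^sub>j X\<^sub>i X\<^sub>j\<close> with indices \<open>i \<le> j < n\<close>. A function \<open>x :: nat \<Rightarrow> _\<close> stands for the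
  vector \<open>(x 0, \<dots>, x (n - 1))\<close>; its values at indices \<open>\<ge> n\<close> are never used.
\<close>

definition qf :: "nat \<Rightarrow> (nat \<Rightarrow> nat \<Rightarrow> 'a::comm_ring_1) \<Rightarrow> (nat \<Rightarrow> 'a) \<Rightarrow> 'a" where
  "qf n a x = (\<Sum>i<n. \<Sum>j\<in>{i..<n}. a i j * x i * x j)"

definition qf_frac :: "nat \<Rightarrow> (nat \<Rightarrow> nat \<Rightarrow> 'r::idom) \<Rightarrow> (nat \<Rightarrow> 'r fract) \<Rightarrow> 'r fract" where
  "qf_frac n a = qf n (\<lambda>i j. Fract (a i j) 1)"

definition qf_polar :: "nat \<Rightarrow> (nat \<Rightarrow> nat \<Rightarrow> 'r::idom) \<Rightarrow>
    (nat \<Rightarrow> 'r fract) \<Rightarrow> (nat \<Rightarrow> 'r fract) \<Rightarrow> 'r fract" where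
  "qf_polar n a u w = qf_frac n a (\<lambda>i. u i + w i) - qf_frac n a u - qf_frac n a w"

definition nondegenerate :: "nat \<Rightarrow> (nat \<Rightarrow> nat \<Rightarrow> 'r::idom) \<Rightarrow> bool" where
  "nondegenerate n a \<longleftrightarrow> (\<forall>u. (\<forall>w. qf_polar n a u w = 0) \<longrightarrow> (\<forall>i<n. u i = 0))"

definition anisotropic :: "nat \<Rightarrow> (nat \<Rightarrow> nat \<Rightarrow> 'r::idom) \<Rightarrow> bool" where
  "anisotropic n a \<longleftrightarrow> (\<forall>w. qf_frac n a w = 0 \<longrightarrow> (\<forall>i<n. w i = 0))"

definition ADC :: "nat \<Rightarrow> (nat \<Rightarrow> nat \<Rightarrow> 'r::idom) \<Rightarrow> bool" where
  "ADC n a \<longleftrightarrow> (\<forall>x. (\<exists>w. Fract x 1 = qf_frac n a w) \<longrightarrow> (\<exists>w'. x = qf n a w'))"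

definition nonzero_values :: "nat \<Rightarrow> (nat \<Rightarrow> nat \<Rightarrow> 'r::idom) \<Rightarrow> 'r set" where
  "nonzero_values n a = range (qf n a) - {0}"

definition qf_density :: "'r measure \<Rightarrow> nat \<Rightarrow> (nat \<Rightarrow> nat \<Rightarrow> 'r::idom) \<Rightarrow> real" where
  "qf_density \<mu> n a = measure \<mu> (nonzero_values n a)"

end

theory Submission
  imports Defs
begin

text \<open>
  Over the fraction field \<open>K\<close> an anisotropic form is equivalent to \<open>N\<^sub>0 \<bottom> \<pi> N\<^sub>1\<close> with unit diagonal
  forms \<open>N\<^sub>0\<close>, \<open>N\<^sub>1\<close>. By Hensel's lemma both are anisotropic modulo \<open>\<pi>\<close>, so they have ranks
  \<open>r, s \<le> 2\<close>, and \<open>\<pi>\<^sup>2 | N\<^sub>0(z) + \<pi> N\<^sub>1(z)\<close> forces \<open>\<pi> | z\<close>. By this descent every element of \<open>R\<close>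
  represented over \<open>K\<close> is \<open>N\<^sub>0(z) + \<pi> N\<^sub>1(z)\<close> for a vector \<open>z\<close> over \<open>R\<close>, and the values form the
  union of exactly \<open>r\<close> square classes of even and \<open>s\<close> square classes of odd valuation. A square
  class meets \<open>R\<close> in measure \<open>q / (2 (q + 1))\<close> or \<open>1 / (2 (q + 1))\<close> according to this parity, so the
  density is \<open>(r q + s) / (2 (q + 1))\<close>. Conversely \<open>N\<^sub>0\<close>, \<open>N\<^sub>1\<close> can be taken to be initial segments
  of \<open>\<langle>1, -\<epsilon>\<rangle>\<close> with \<open>\<epsilon>\<close> a nonsquare unit, and the resulting form is ADC by descent.
\<close>

section \<open>Ideals\<close>

lemma module_mult: "module ((*) :: 'r::comm_ring_1 \<Rightarrow> 'r \<Rightarrow> 'r)"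
  by unfold_locales (simp_all add: algebra_simps)

lemma ring_ideal_iff:
  "ring_ideal I \<longleftrightarrow> 0 \<in> I \<and> (\<forall>x\<in>I. \<forall>y\<in>I. x + y \<in> I) \<and> (\<forall>c. \<forall>x\<in>I. c * x \<in> I)"
  unfolding ring_ideal_def by (rule module.subspace_def[OF module_mult])

lemma ring_ideal_multiples: "ring_ideal {x. a dvd x}"
  by (simp add: ring_ideal_iff)

lemma span_singleton_eq_multiples: "module.span (*) {a} = {x :: 'r::comm_ring_1. a dvd x}"
  unfolding module.span_singleton[OF module_mult] by (auto simp: dvd_def mult.commute)

lemma ideal_power_multiples:
  "ideal_power {x :: 'r::comm_ring_1. p dvd x} k = {x. p ^ k dvd x}"
proof (induction k)
  case (Suc k)
  let ?S = "{x * y | x y. p dvd x \<and> p ^ k dvd y}"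
  have "x \<in> ?S" if x: "p ^ Suc k dvd x" for x
  proof -
    obtain c where "x = p * (p ^ k * c)"
      using x by (auto simp: mult.assoc)
    then show ?thesis
      using dvd_refl[of p] dvd_triv_left[of "p ^ k" c] by blast
  qed
  then have "?S = {x. p ^ Suc k dvd x}"
    by (auto intro: mult_dvd_mono)
  moreover have "module.span (*) {x. p ^ Suc k dvd x} = {x. p ^ Suc k dvd x}"
    by (simp add: module.span_eq_iff[OF module_mult] ring_ideal_multiples[unfolded ring_ideal_def])
  ultimately show ?case
    using Suc by simp
qed simp

lemma ring_ideal_eq_UNIV_iff: "ring_ideal I \<Longrightarrow> I = UNIV \<longleftrightarrow> 1 \<in> I"
  unfolding ring_ideal_iff by (metis UNIV_eq_I UNIV_I mult.right_neutral)

lemma ring_ideal_Union_chain: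
  assumes "\<C> \<noteq> {}" "subset.chain {I. ring_ideal I} \<C>"
  shows "ring_ideal (\<Union>\<C>)"
proof -
  have ideal: "ring_ideal I" if "I \<in> \<C>" for I
    using assms(2) that unfolding subset_chain_def by blast
  have "x + y \<in> \<Union>\<C>" if xy: "x \<in> \<Union>\<C>" "y \<in> \<Union>\<C>" for x y
  proof -
    obtain I J where IJ: "I \<in> \<C>" "J \<in> \<C>" "x \<in> I" "y \<in> J"
      using xy by blast
    then have "I \<subseteq> J \<or> J \<subseteq> I"
      using assms(2) unfolding subset_chain_def by blast
    then obtain L where "L \<in> \<C>" "x \<in> L" "y \<in> L"
      using IJ by blast
    then show ?thesis
      using ideal[of L] unfolding ring_ideal_iff by blast
  qed
  then show ?thesis
    using assms(1) ideal unfolding ring_ideal_iff by blast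
qed

lemma proper_ideal_subset_maximal:
  assumes "ring_ideal I" "1 \<notin> I"
  obtains M where "maximal_ring_ideal M" "I \<subseteq> M"
proof -
  let ?P = "{J. ring_ideal J \<and> I \<subseteq> J \<and> 1 \<notin> J}"
  have "\<exists>M\<in>?P. \<forall>J\<in>?P. M \<subseteq> J \<longrightarrow> J = M"
  proof (rule subset_Zorn_nonempty)
    show "?P \<noteq> {}"
      using assms by blast
    fix \<C> assume "\<C> \<noteq> {}" and chain: "subset.chain ?P \<C>"
    then have "ring_ideal (\<Union>\<C>)"
      by (intro ring_ideal_Union_chain) (auto simp: subset_chain_def)
    then show "\<Union>\<C> \<in> ?P"
      using \<open>\<C> \<noteq> {}\<close> chain unfolding subset_chain_def by blast
  qed
  then obtain M where M: "M \<in> ?P" and greatest: "\<forall>J\<in>?P. M \<subseteq> J \<longrightarrow> J = M"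
    by blast
  have "J = M \<or> J = UNIV" if "ring_ideal J" "M \<subseteq> J" for J
    using M greatest that ring_ideal_eq_UNIV_iff[of J] by blast
  moreover have "M \<noteq> UNIV"
    using M by blast
  ultimately have "maximal_ring_ideal M"
    using M unfolding maximal_ring_ideal_def by blast
  with M show thesis
    by (intro that) auto
qed

section \<open>Discrete valuation rings\<close>

lemma dvd_diff_swap: "a dvd x - y \<longleftrightarrow> a dvd y - x" for a :: "'a::comm_ring_1"
  by (metis dvd_minus_iff minus_diff_eq)

context discrete_valuation_ring
begin

definition uniformizer :: 'r ("\<pi>") where
  "\<pi> = (SOME p. \<mm> = {x. p dvd x})"

lemma maximal_eq_multiples: "\<mm> = {x. \<pi> dvd x}"
proof -
  have "ring_ideal \<mm>"
    using maximal unfolding maximal_ring_ideal_def by blast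
  then have "\<exists>p. \<mm> = {x. p dvd x}"
    using principal unfolding span_singleton_eq_multiples by blast
  then show ?thesis
    unfolding uniformizer_def by (rule someI_ex)
qed

lemma mem_maximal_iff: "x \<in> \<mm> \<longleftrightarrow> \<pi> dvd x"
  using maximal_eq_multiples by blast

lemma ideal_power_maximal: "ideal_power \<mm> k = {x. \<pi> ^ k dvd x}"
  by (rule ideal_power_multiples[of \<pi>, folded maximal_eq_multiples])

lemma uniformizer_nonzero: "\<pi> \<noteq> 0"
proof
  assume "\<pi> = 0"
  then have "\<mm> = {0}"
    by (auto simp: mem_maximal_iff)
  with not_field show False
    by simp
qed

lemma not_uniformizer_dvd_1: "\<not> \<pi> dvd 1"
  using maximal ring_ideal_eq_UNIV_iff[of \<mm>]
  by (simp add: maximal_ring_ideal_def mem_maximal_iff)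

lemma not_uniformizer_dvd_iff_unit: "\<not> \<pi> dvd x \<longleftrightarrow> x dvd 1"
proof
  assume "\<not> \<pi> dvd x"
  show "x dvd 1"
  proof (rule ccontr)
    assume "\<not> x dvd 1"
    then obtain M where "maximal_ring_ideal M" "{y. x dvd y} \<subseteq> M"
      using proper_ideal_subset_maximal[OF ring_ideal_multiples] by blast
    with \<open>\<not> \<pi> dvd x\<close> show False
      using local[of M] mem_maximal_iff[of x] by (metis CollectI dvd_refl subsetD)
  qed
qed (use not_uniformizer_dvd_1 dvd_trans in blast)

lemma unit_inverse:
  assumes "\<not> \<pi> dvd u"
  obtains v where "u * v = 1" "\<not> \<pi> dvd v"
proof -
  obtain v where "u * v = 1"
    using assms not_uniformizer_dvd_iff_unit by (metis dvdE)
  moreover from this have "\<not> \<pi> dvd v"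
    using not_uniformizer_dvd_1 by (metis dvd_mult)
  ultimately show thesis
    by (rule that)
qed

lemma prime_elem_uniformizer: "prime_elem \<pi>"
  unfolding prime_elem_def
proof (intro conjI allI impI uniformizer_nonzero not_uniformizer_dvd_1)
  fix x y assume xy: "\<pi> dvd x * y"
  show "\<pi> dvd x \<or> \<pi> dvd y"
  proof (rule ccontr)
    assume "\<not> (\<pi> dvd x \<or> \<pi> dvd y)"
    then have "x * y dvd 1 * 1"
      by (intro mult_dvd_mono) (auto simp: not_uniformizer_dvd_iff_unit[symmetric])
    with xy show False
      using not_uniformizer_dvd_1 dvd_trans by (simp, blast)
  qed
qed

lemmas uniformizer_dvd_mult_iff = prime_elem_dvd_mult_iff[OF prime_elem_uniformizer]

lemma uniformizer_dvd_square_iff: "\<pi> dvd x\<^sup>2 \<longleftrightarrow> \<pi> dvd x"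
  by (simp add: power2_eq_square uniformizer_dvd_mult_iff)

lemma uniformizer_dvd_cong: "\<pi> dvd x - y \<Longrightarrow> \<pi> dvd x \<longleftrightarrow> \<pi> dvd y"
  by (metis diff_add_cancel dvd_add_right_iff)

lemma uniformizer_power_Suc_dvd_iff: "\<pi> ^ Suc k dvd \<pi> ^ k * x \<longleftrightarrow> \<pi> dvd x"
  by (simp only: power_Suc2 dvd_mult_cancel_left) (simp add: uniformizer_nonzero)

text \<open>The \<open>x\<close> divisible by all powers of \<open>\<pi>\<close> form a principal ideal, and its generator divided by
  \<open>\<pi>\<close> lies in it again.\<close>

lemma eq_0_if_all_powers_dvd:
  assumes "\<And>k. \<pi> ^ k dvd x"
  shows "x = 0"
proof -
  let ?J = "{x. \<forall>k. \<pi> ^ k dvd x}"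
  have "ring_ideal ?J"
    by (auto simp: ring_ideal_iff)
  then obtain b where b: "?J = {x. b dvd x}"
    using principal[of ?J] unfolding span_singleton_eq_multiples by blast
  have "b \<in> ?J"
    unfolding b by simp
  then have power_dvd_b: "\<pi> ^ k dvd b" for k
    by blast
  obtain c where c: "b = \<pi> * c"
    using power_dvd_b[of 1] by (auto elim: dvdE)
  have "\<pi> ^ k dvd c" for k
    using power_dvd_b[of "Suc k"] uniformizer_nonzero by (simp add: c)
  then have "c \<in> ?J"
    by blast
  then have "b dvd c"
    unfolding b by simp
  then obtain d where d: "c = b * d"
    by (rule dvdE)
  have "b * (1 - \<pi> * d) = b - \<pi> * (b * d)"
    by (simp add: algebra_simps)
  also have "\<dots> = 0"
    by (simp flip: c d)
  finally have "b * (1 - \<pi> * d) = 0" .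
  moreover have "1 - \<pi> * d \<noteq> 0"
    using not_uniformizer_dvd_1 by (metis dvd_triv_left eq_iff_diff_eq_0)
  ultimately have "b = 0"
    by simp
  moreover have "x \<in> ?J"
    using assms by blast
  then have "b dvd x"
    unfolding b by simp
  ultimately show ?thesis
    by simp
qed

lemma uniformizer_factorization:
  assumes "x \<noteq> 0"
  obtains k u where "x = u * \<pi> ^ k" "\<not> \<pi> dvd u"
proof -
  define k where "k = (LEAST k. \<not> \<pi> ^ k dvd x)"
  have "\<exists>k. \<not> \<pi> ^ k dvd x"
    using assms eq_0_if_all_powers_dvd by blast
  then have not_dvd: "\<not> \<pi> ^ k dvd x"
    unfolding k_def by (rule LeastI_ex)
  then obtain j where j: "k = Suc j"
    by (cases k) auto
  then have "\<pi> ^ j dvd x"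
    using not_less_Least[of j "\<lambda>k. \<not> \<pi> ^ k dvd x"] k_def by auto
  then obtain u where u: "x = u * \<pi> ^ j"
    by (metis dvdE mult.commute)
  moreover have "\<not> \<pi> dvd u"
    using not_dvd j u by (auto simp: mult_dvd_mono)
  ultimately show thesis
    by (rule that)
qed

lemma uniformizer_factorization_unique:
  assumes "u * \<pi> ^ j = v * \<pi> ^ k" "\<not> \<pi> dvd u" "\<not> \<pi> dvd v"
  shows "j = k" "u = v"
proof -
  have "k' \<le> j'" if "u' * \<pi> ^ j' = v' * \<pi> ^ k'" "\<not> \<pi> dvd u'" for u' v' j' k'
  proof (rule ccontr)
    assume "\<not> k' \<le> j'"
    then have "\<pi> ^ Suc j' dvd v' * \<pi> ^ k'"
      by (simp add: le_imp_power_dvd dvd_mult del: power_Suc)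
    then have "\<pi> ^ Suc j' dvd \<pi> ^ j' * u'"
      using that(1) by (simp add: mult.commute)
    with that(2) show False
      by (simp only: uniformizer_power_Suc_dvd_iff)
  qed
  from this[OF assms(1,2)] this[OF assms(1)[symmetric] assms(3)] show "j = k"
    by simp
  with assms(1) uniformizer_nonzero show "u = v"
    by simp
qed

lemma fract_eq_unit_times_square:
  fixes c :: "'r fract"
  assumes "c \<noteq> 0"
  obtains v e t where "\<not> \<pi> dvd v" "e < (2::nat)" "t \<noteq> 0" "c = to_fract (v * \<pi> ^ e) * t\<^sup>2"
proof -
  obtain p r where pr: "c = to_fract p / to_fract r" "r \<noteq> 0"
    by (cases c) (auto simp: Fract_conv_to_fract)
  then have "p * r \<noteq> 0"
    using assms by auto
  then obtain m v where v: "p * r = v * \<pi> ^ m" "\<not> \<pi> dvd v"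
    by (rule uniformizer_factorization)
  have m: "m = m mod 2 + m div 2 * 2"
    by simp
  have "p * r = v * \<pi> ^ (m mod 2) * (\<pi> ^ (m div 2))\<^sup>2"
    unfolding v(1) by (subst m) (simp only: power_add power_mult mult.assoc)
  moreover have "c = to_fract (p * r) / (to_fract r)\<^sup>2"
    using pr by (simp add: power2_eq_square)
  ultimately have "c = to_fract (v * \<pi> ^ (m mod 2)) * (to_fract (\<pi> ^ (m div 2)) / to_fract r)\<^sup>2"
    by (simp add: power2_eq_square)
  then show thesis
    using v(2) pr(2) uniformizer_nonzero by (intro that[of v "m mod 2"]) auto
qed

end

section \<open>Squares in a finite residue field of odd cardinality\<close>

context discrete_valuation_ring
begin

definition residue_rep :: "'r \<Rightarrow> 'r" where
  "residue_rep x = (SOME y. \<pi> dvd x - y)"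

definition residue_reps :: "'r set" where
  "residue_reps = range residue_rep"

lemma residue_rep_in_residue_reps [simp]: "residue_rep x \<in> residue_reps"
  by (simp add: residue_reps_def)

lemma uniformizer_dvd_diff_residue_rep: "\<pi> dvd x - residue_rep x"
  unfolding residue_rep_def by (rule someI[of _ x]) simp

lemma residue_rep_eq_iff: "residue_rep x = residue_rep y \<longleftrightarrow> \<pi> dvd x - y"
proof
  assume "residue_rep x = residue_rep y"
  then show "\<pi> dvd x - y"
    using dvd_diff[OF uniformizer_dvd_diff_residue_rep[of x] uniformizer_dvd_diff_residue_rep[of y]]
    by simp
next
  assume xy: "\<pi> dvd x - y"
  have "\<pi> dvd x - z \<longleftrightarrow> \<pi> dvd y - z" for z
    by (rule uniformizer_dvd_cong) (use xy in simp)
  then show "residue_rep x = residue_rep y"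
    by (simp add: residue_rep_def)
qed

lemma residue_rep_idem: "residue_rep (residue_rep x) = residue_rep x"
  by (metis uniformizer_dvd_diff_residue_rep residue_rep_eq_iff)

lemma residue_rep_eq_self: "t \<in> residue_reps \<Longrightarrow> residue_rep t = t"
  by (auto simp: residue_reps_def residue_rep_idem)

lemma residue_reps_eq_iff: "s \<in> residue_reps \<Longrightarrow> t \<in> residue_reps \<Longrightarrow> s = t \<longleftrightarrow> \<pi> dvd s - t"
  by (metis residue_rep_eq_self residue_rep_eq_iff)

lemma bij_betw_residue_reps: "bij_betw (\<lambda>t. {y. t - y \<in> \<mm>}) residue_reps (residue_field \<mm>)"
proof (rule bij_betw_imageI)
  show "inj_on (\<lambda>t. {y. t - y \<in> \<mm>}) residue_reps"
  proof (rule inj_onI)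
    fix s t assume st: "s \<in> residue_reps" "t \<in> residue_reps" "{y. s - y \<in> \<mm>} = {y. t - y \<in> \<mm>}"
    have "t \<in> {y. t - y \<in> \<mm>}"
      by (simp add: mem_maximal_iff)
    then have "\<pi> dvd s - t"
      unfolding st(3)[symmetric] by (simp add: mem_maximal_iff)
    with st(1,2) show "s = t"
      by (simp add: residue_reps_eq_iff)
  qed
  have "{y. residue_rep x - y \<in> \<mm>} = {y. x - y \<in> \<mm>}" for x
    by (simp add: mem_maximal_iff residue_rep_eq_iff[symmetric] residue_rep_idem)
  then show "(\<lambda>t. {y. t - y \<in> \<mm>}) ` residue_reps = residue_field \<mm>"
    by (auto simp: residue_reps_def residue_field_def quotient_def)
qed

lemma card_residue_reps: "card residue_reps = card (residue_field \<mm>)"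
  using bij_betw_residue_reps by (rule bij_betw_same_card)

lemma inj_on_residue_rep_affine:
  assumes "\<not> \<pi> dvd u"
  shows "inj_on (\<lambda>t. residue_rep (c + u * t)) residue_reps"
proof (rule inj_onI)
  fix s t assume st: "s \<in> residue_reps" "t \<in> residue_reps"
    and "residue_rep (c + u * s) = residue_rep (c + u * t)"
  then have "\<pi> dvd u * (s - t)"
    by (simp add: residue_rep_eq_iff algebra_simps)
  with assms st show "s = t"
    by (simp add: uniformizer_dvd_mult_iff residue_reps_eq_iff)
qed

definition residue_square :: "'r \<Rightarrow> bool" where
  "residue_square u \<longleftrightarrow> (\<exists>t. \<pi> dvd u - t\<^sup>2)"

lemma residue_square_square [simp]: "residue_square (t\<^sup>2)"
  unfolding residue_square_def by (rule exI[of _ t]) simp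

lemma residue_square_cong:
  assumes "\<pi> dvd u - v"
  shows "residue_square u \<longleftrightarrow> residue_square v"
proof -
  have "\<pi> dvd u - t\<^sup>2 \<longleftrightarrow> \<pi> dvd v - t\<^sup>2" for t
    by (rule uniformizer_dvd_cong) (use assms in simp)
  then show ?thesis
    by (simp add: residue_square_def)
qed

lemma residue_square_mult:
  assumes "residue_square u" "residue_square v"
  shows "residue_square (u * v)"
proof -
  obtain s t where "\<pi> dvd u - s\<^sup>2" "\<pi> dvd v - t\<^sup>2"
    using assms unfolding residue_square_def by blast
  then have "\<pi> dvd (u - s\<^sup>2) * v + s\<^sup>2 * (v - t\<^sup>2)"
    by simp
  then have "\<pi> dvd u * v - (s * t)\<^sup>2"
    by (simp add: algebra_simps power_mult_distrib)
  then show ?thesis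
    unfolding residue_square_def by blast
qed

lemma residue_square_mult_square_iff:
  assumes "\<not> \<pi> dvd t"
  shows "residue_square (u * t\<^sup>2) \<longleftrightarrow> residue_square u"
proof
  obtain v where "t * v = 1"
    using unit_inverse[OF assms] by blast
  then have cancel: "u * t\<^sup>2 * v\<^sup>2 = u"
    by (metis mult.assoc mult.right_neutral power_mult_distrib power_one)
  then show "residue_square u" if "residue_square (u * t\<^sup>2)"
    using residue_square_mult[OF that residue_square_square[of v]] by (simp only: cancel)
qed (simp add: residue_square_mult)

definition unit_reps :: "'r set" where
  "unit_reps = {t \<in> residue_reps. \<not> \<pi> dvd t}"

text \<open>The two classes of units modulo squares are named by the truth value of
  \<^const>\<open>residue_square\<close>.\<close>

definition class_reps :: "bool \<Rightarrow> 'r set" where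
  "class_reps b = {t \<in> unit_reps. residue_square t = b}"

lemma class_reps_subset: "class_reps b \<subseteq> residue_reps"
  by (auto simp: class_reps_def unit_reps_def)

lemma residue_rep_in_unit_reps_iff: "residue_rep x \<in> unit_reps \<longleftrightarrow> \<not> \<pi> dvd x"
  using uniformizer_dvd_cong[OF uniformizer_dvd_diff_residue_rep[of x]] by (simp add: unit_reps_def)

lemma residue_rep_in_class_reps_iff:
  "residue_rep x \<in> class_reps b \<longleftrightarrow> \<not> \<pi> dvd x \<and> residue_square x = b"
  using residue_square_cong[OF uniformizer_dvd_diff_residue_rep[of x]]
  by (simp add: class_reps_def residue_rep_in_unit_reps_iff)

lemma residue_reps_eq_insert_unit_reps: "residue_reps = insert (residue_rep 0) unit_reps"
proof -
  have "t = residue_rep 0" if "t \<in> residue_reps" "\<pi> dvd t" for t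
    using that residue_rep_eq_iff[of t 0] residue_rep_eq_self by simp
  then show ?thesis
    by (auto simp: unit_reps_def)
qed

lemma squares_of_unit_reps: "(\<lambda>t. residue_rep (t\<^sup>2)) ` unit_reps = class_reps True"
proof (intro equalityI subsetI)
  fix y assume "y \<in> (\<lambda>t. residue_rep (t\<^sup>2)) ` unit_reps"
  then show "y \<in> class_reps True"
    by (auto simp: residue_rep_in_class_reps_iff uniformizer_dvd_square_iff unit_reps_def)
next
  fix y assume y: "y \<in> class_reps True"
  then obtain s where s: "\<pi> dvd y - s\<^sup>2"
    by (auto simp: class_reps_def residue_square_def)
  have "\<pi> dvd (s - residue_rep s) * (s + residue_rep s)"
    using uniformizer_dvd_diff_residue_rep by simp
  with s have "\<pi> dvd (y - s\<^sup>2) + (s - residue_rep s) * (s + residue_rep s)"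
    by (rule dvd_add)
  then have "\<pi> dvd y - (residue_rep s)\<^sup>2"
    by (simp add: power2_eq_square algebra_simps)
  then have "y = residue_rep ((residue_rep s)\<^sup>2)"
    using y residue_rep_eq_self[of y] residue_rep_eq_iff[of y]
    by (simp add: class_reps_def unit_reps_def)
  moreover have "residue_rep s \<in> unit_reps"
    using y uniformizer_dvd_cong[OF s] unfolding residue_rep_in_unit_reps_iff
    by (simp add: class_reps_def unit_reps_def uniformizer_dvd_square_iff)
  ultimately show "y \<in> (\<lambda>t. residue_rep (t\<^sup>2)) ` unit_reps"
    by blast
qed

end

locale finite_residue_dvr = discrete_valuation_ring \<mm> for \<mm> :: "'r::idom set" +
  assumes finite_residue_field: "finite (residue_field \<mm>)"
begin

abbreviation q :: nat where
  "q \<equiv> card (residue_field \<mm>)"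

lemma finite_residue_reps [simp]: "finite residue_reps"
  using bij_betw_residue_reps finite_residue_field bij_betw_finite by blast

lemma finite_unit_reps [simp]: "finite unit_reps"
  by (simp add: unit_reps_def)

lemma finite_class_reps [simp]: "finite (class_reps b)"
  using class_reps_subset finite_residue_reps by (rule finite_subset)

lemma card_residue_field_pos: "q > 0"
  using residue_rep_in_residue_reps[of 0] finite_residue_reps
  unfolding card_residue_reps[symmetric] card_gt_0_iff by blast

end

locale odd_residue_dvr = finite_residue_dvr \<mm> for \<mm> :: "'r::idom set" +
  assumes odd_card_residue_field: "odd q"
begin

text \<open>Translation by 1 permutes the residues; summing them all shows that \<open>q\<close> vanishes in the
  residue field, so 2 does not.\<close>

lemma not_uniformizer_dvd_2: "\<not> \<pi> dvd 2"
proof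
  assume two: "\<pi> dvd 2"
  let ?shift = "\<lambda>t. residue_rep (1 + t)"
  have inj: "inj_on ?shift residue_reps"
    using inj_on_residue_rep_affine[of 1 1] not_uniformizer_dvd_1 by simp
  then have "?shift ` residue_reps = residue_reps"
    by (intro endo_inj_surj) auto
  then have "(\<Sum>t\<in>residue_reps. t) = (\<Sum>t\<in>residue_reps. ?shift t)"
    using sum.reindex[OF inj, of "\<lambda>t. t"] by simp
  then have "of_nat q = (\<Sum>t\<in>residue_reps. (1 + t) - ?shift t)"
    by (simp add: sum_subtractf sum.distrib card_residue_reps)
  then have "\<pi> dvd of_nat q"
    using uniformizer_dvd_diff_residue_rep by (auto intro: dvd_sum)
  moreover obtain k where "q = 2 * k + 1"
    using odd_card_residue_field by (elim oddE)
  ultimately have "\<pi> dvd 2 * of_nat k + 1"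
    by (simp add: add.commute)
  with two have "\<pi> dvd 1"
    by (metis dvd_add_right_iff dvd_mult2)
  with not_uniformizer_dvd_1 show False ..
qed

lemma fibre_of_squaring:
  assumes s: "s \<in> unit_reps"
  shows "{t \<in> unit_reps. residue_rep (t\<^sup>2) = residue_rep (s\<^sup>2)} = {s, residue_rep (- s)}"
    and "s \<noteq> residue_rep (- s)"
proof -
  have s': "residue_rep s = s" "\<not> \<pi> dvd s"
    using s by (auto simp: unit_reps_def residue_rep_eq_self)
  have "residue_rep (t\<^sup>2) = residue_rep (s\<^sup>2) \<longleftrightarrow> t = s \<or> t = residue_rep (- s)"
    if "t \<in> unit_reps" for t
  proof -
    have "residue_rep (t\<^sup>2) = residue_rep (s\<^sup>2) \<longleftrightarrow> \<pi> dvd (t - s) * (t - - s)"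
      by (simp add: residue_rep_eq_iff power2_eq_square algebra_simps)
    also have "\<dots> \<longleftrightarrow> residue_rep t = residue_rep s \<or> residue_rep t = residue_rep (- s)"
      by (simp only: uniformizer_dvd_mult_iff residue_rep_eq_iff)
    finally show ?thesis
      using that s' by (simp add: unit_reps_def residue_rep_eq_self)
  qed
  moreover have "residue_rep (- s) \<in> unit_reps"
    using s' by (simp add: residue_rep_in_unit_reps_iff)
  ultimately show "{t \<in> unit_reps. residue_rep (t\<^sup>2) = residue_rep (s\<^sup>2)} = {s, residue_rep (- s)}"
    using s by blast
  have "\<not> \<pi> dvd s - - s"
    using s'(2) not_uniformizer_dvd_2 uniformizer_dvd_mult_iff[of 2 s] by simp
  then show "s \<noteq> residue_rep (- s)"
    using s'(1) residue_rep_eq_iff by metis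
qed

lemma card_unit_reps: "card unit_reps = 2 * card (class_reps True)"
proof -
  have "card unit_reps = (\<Sum>y\<in>class_reps True. card {t \<in> unit_reps. residue_rep (t\<^sup>2) = y})"
    unfolding card_eq_sum squares_of_unit_reps[symmetric] by (rule sum.image_gen) simp
  also have "\<dots> = (\<Sum>y\<in>class_reps True. 2)"
  proof (rule sum.cong)
    fix y assume "y \<in> class_reps True"
    then obtain s where "s \<in> unit_reps" "y = residue_rep (s\<^sup>2)"
      using squares_of_unit_reps by blast
    then show "card {t \<in> unit_reps. residue_rep (t\<^sup>2) = y} = 2"
      by (simp add: fibre_of_squaring)
  qed simp
  finally show ?thesis
    by simp
qed

lemma card_residue_field_eq: "q = 2 * card (class_reps b) + 1"
proof -
  have "residue_rep 0 \<notin> unit_reps"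
    by (simp add: residue_rep_in_unit_reps_iff)
  then have "q = Suc (card unit_reps)"
    by (simp add: card_residue_reps[symmetric] residue_reps_eq_insert_unit_reps)
  moreover have "class_reps False = unit_reps - class_reps True" "class_reps True \<subseteq> unit_reps"
    by (auto simp: class_reps_def)
  then have "card (class_reps False) = card unit_reps - card (class_reps True)"
    by (simp add: card_Diff_subset)
  ultimately show ?thesis
    using card_unit_reps by (cases b) simp_all
qed

lemma card_class_reps_pos: "card (class_reps b) > 0"
proof -
  have "residue_square 1"
    using residue_square_square[of 1] by simp
  then have "residue_rep 1 \<in> class_reps True"
    using not_uniformizer_dvd_1 by (simp add: residue_rep_in_class_reps_iff)
  then have "card (class_reps True) > 0"
    by (auto simp: card_gt_0_iff)
  then show ?thesis
    using card_residue_field_eq[of True] card_residue_field_eq[of b] by simp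
qed

lemma card_residue_field_gt_1: "q > 1"
  using card_residue_field_eq[of True] card_class_reps_pos[of True] by simp

lemma ex_unit_in_class: "\<exists>u. \<not> \<pi> dvd u \<and> residue_square u = b"
proof -
  have "class_reps b \<noteq> {}"
    using card_class_reps_pos by (metis card.empty less_numeral_extra(3))
  then show ?thesis
    by (auto simp: class_reps_def unit_reps_def)
qed

text \<open>Multiplication by a nonsquare unit injects the nonzero squares into the equally many
  nonsquares.\<close>

lemma residue_square_mult_nonsquares:
  assumes u: "\<not> \<pi> dvd u" "\<not> residue_square u" and v: "\<not> \<pi> dvd v" "\<not> residue_square v"
  shows "residue_square (u * v)"
proof -
  let ?f = "\<lambda>s. residue_rep (u * s)"
  have "?f s \<in> class_reps False" if s: "s \<in> class_reps True" for s
  proof -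
    obtain r where r: "\<pi> dvd s - r\<^sup>2"
      using s by (auto simp: class_reps_def residue_square_def)
    have "\<not> \<pi> dvd s"
      using s by (simp add: class_reps_def unit_reps_def)
    then have "\<not> residue_square (u * r\<^sup>2)"
      using u uniformizer_dvd_cong[OF r]
      by (simp add: residue_square_mult_square_iff uniformizer_dvd_square_iff)
    moreover have "\<pi> dvd u * s - u * r\<^sup>2"
      using r by (metis dvd_mult right_diff_distrib)
    ultimately show ?thesis
      using u(1) \<open>\<not> \<pi> dvd s\<close> residue_square_cong
      by (auto simp: residue_rep_in_class_reps_iff uniformizer_dvd_mult_iff)
  qed
  moreover have "inj_on ?f (class_reps True)"
    using inj_on_subset[OF inj_on_residue_rep_affine[OF u(1), of 0] class_reps_subset] by simp
  ultimately have "?f ` class_reps True = class_reps False"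
    using card_residue_field_eq[of True] card_residue_field_eq[of False]
    by (intro card_subset_eq) (auto simp: card_image)
  moreover have "residue_rep v \<in> class_reps False"
    using v by (simp add: residue_rep_in_class_reps_iff)
  ultimately obtain s where s: "s \<in> class_reps True" "residue_rep v = residue_rep (u * s)"
    by blast
  then have "\<pi> dvd u * (v - u * s)"
    by (simp add: residue_rep_eq_iff)
  then have "\<pi> dvd u * v - s * u\<^sup>2"
    by (simp add: power2_eq_square algebra_simps)
  moreover have "residue_square (s * u\<^sup>2)"
    using s(1) u(1) by (simp add: residue_square_mult_square_iff class_reps_def)
  ultimately show ?thesis
    using residue_square_cong by blast
qed

text \<open>Pigeonhole: \<open>u x\<^sup>2\<close> and \<open>w - v y\<^sup>2\<close> each take \<open>(q + 1) / 2\<close> of the \<open>q\<close> residues.\<close>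

lemma binary_unit_form_universal:
  assumes u: "\<not> \<pi> dvd u" and v: "\<not> \<pi> dvd v"
  obtains x y where "\<pi> dvd w - (u * x\<^sup>2 + v * y\<^sup>2)"
proof -
  define Q where "Q = insert (residue_rep 0) (class_reps True)"
  have "residue_rep 0 \<notin> class_reps True"
    by (simp add: residue_rep_in_class_reps_iff)
  then have card_Q: "2 * card Q > q"
    unfolding Q_def using card_residue_field_eq[of True] by simp
  have Q_subset: "Q \<subseteq> residue_reps"
    using class_reps_subset by (auto simp: Q_def)
  have Q_square: "\<exists>s. \<pi> dvd t - s\<^sup>2" if "t \<in> Q" for t
    using that residue_square_cong[of 0 "residue_rep 0"] uniformizer_dvd_diff_residue_rep[of 0]
      residue_square_square[of 0]
    by (auto simp: Q_def class_reps_def residue_square_def[symmetric])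
  let ?A = "(\<lambda>t. residue_rep (u * t)) ` Q" and ?B = "(\<lambda>t. residue_rep (w - v * t)) ` Q"
  have "inj_on (\<lambda>t. residue_rep (u * t)) residue_reps"
    "inj_on (\<lambda>t. residue_rep (w - v * t)) residue_reps"
    using inj_on_residue_rep_affine[of u 0] inj_on_residue_rep_affine[of "- v" w] assms by simp_all
  then have "card ?A = card Q" "card ?B = card Q"
    using Q_subset by (simp_all add: card_image inj_on_subset)
  moreover have "card (?A \<union> ?B) \<le> q"
    unfolding card_residue_reps[symmetric] by (intro card_mono) auto
  moreover have "finite Q"
    using Q_subset finite_residue_reps by (rule finite_subset)
  ultimately have "?A \<inter> ?B \<noteq> {}"
    using card_Q card_Un_disjoint[of ?A ?B] by auto
  then obtain a b where ab: "a \<in> Q" "b \<in> Q" "residue_rep (u * a) = residue_rep (w - v * b)"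
    by blast
  then obtain x y where xy: "\<pi> dvd a - x\<^sup>2" "\<pi> dvd b - y\<^sup>2"
    using Q_square by blast
  have "\<pi> dvd u * a - (w - v * b)"
    using ab(3) by (simp add: residue_rep_eq_iff)
  then have "\<pi> dvd u * (a - x\<^sup>2) + v * (b - y\<^sup>2) - (u * a - (w - v * b))"
    using xy by simp
  then show thesis
    by (intro that[of x y]) (simp add: algebra_simps)
qed

end

section \<open>Hensel's lemma\<close>

lemma poly_first_order_expansion:
  fixes p :: "'a::idom poly"
  obtains c where "poly p (x + h) = poly p x + h * poly (pderiv p) x + h\<^sup>2 * c"
proof -
  have "\<exists>c. poly p (x + h) = poly p x + h * poly (pderiv p) x + h\<^sup>2 * c"
  proof (induction p)
    case (pCons a p)
    then obtain c where c: "poly p (x + h) = poly p x + h * poly (pderiv p) x + h\<^sup>2 * c"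
      by blast
    have "poly (pCons a p) (x + h) = poly (pCons a p) x + h * poly (pderiv (pCons a p)) x +
        h\<^sup>2 * (poly (pderiv p) x + (x + h) * c)"
      by (simp only: poly_pCons c pderiv_pCons poly_add) (simp add: power2_eq_square algebra_simps)
    then show ?case ..
  qed simp
  with that show thesis
    by blast
qed

lemma diff_dvd_poly_diff:
  fixes p :: "'a::idom poly"
  shows "x - y dvd poly p x - poly p y"
proof -
  obtain c where "poly p (y + (x - y)) = poly p y + (x - y) * poly (pderiv p) y + (x - y)\<^sup>2 * c"
    by (rule poly_first_order_expansion)
  then have "poly p x - poly p y = (x - y) * (poly (pderiv p) y + (x - y) * c)"
    by (simp add: power2_eq_square algebra_simps)
  then show ?thesis
    by simp
qed

lemma (in discrete_valuation_ring) Newton_step: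
  assumes h: "poly (pderiv f) a * h = 1"
    and t: "\<pi> dvd t - a" "\<pi> ^ Suc n dvd poly f t"
  shows "\<pi> dvd t - poly f t * h - a"
    and "\<pi> ^ Suc (Suc n) dvd poly f (t - poly f t * h)"
proof -
  have f_t: "\<pi> dvd poly f t"
    using t(2) by (simp add: dvd_mult_left)
  then have "\<pi> dvd (t - a) - poly f t * h"
    using t(1) by simp
  then show "\<pi> dvd t - poly f t * h - a"
    by (simp add: algebra_simps)
  obtain c where "poly f (t + - (poly f t * h)) =
      poly f t + - (poly f t * h) * poly (pderiv f) t + (- (poly f t * h))\<^sup>2 * c"
    by (rule poly_first_order_expansion)
  also have "\<dots> = poly f t * ((1 - poly (pderiv f) t * h) + poly f t * (h\<^sup>2 * c))"
    by (simp add: power2_eq_square algebra_simps)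
  also have "1 - poly (pderiv f) t * h = - h * (poly (pderiv f) t - poly (pderiv f) a)"
    by (simp add: h[symmetric] algebra_simps)
  finally have "poly f (t - poly f t * h) =
      poly f t * (- h * (poly (pderiv f) t - poly (pderiv f) a) + poly f t * (h\<^sup>2 * c))"
    by simp
  moreover have "\<pi> dvd - h * (poly (pderiv f) t - poly (pderiv f) a) + poly f t * (h\<^sup>2 * c)"
    using dvd_trans[OF t(1) diff_dvd_poly_diff] f_t by (intro dvd_add dvd_mult dvd_mult2)
  ultimately have "\<pi> ^ Suc n * \<pi> dvd poly f (t - poly f t * h)"
    using t(2) by (metis mult_dvd_mono)
  then show "\<pi> ^ Suc (Suc n) dvd poly f (t - poly f t * h)"
    by (simp add: mult_ac)
qed

context complete_discrete_valuation_ring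
begin

lemma limit_of_uniformizer_steps:
  assumes "\<And>n. \<pi> ^ n dvd s (Suc n) - s n"
  obtains l where "\<And>n. \<pi> ^ n dvd l - s n"
proof -
  have steps: "\<pi> ^ n dvd s m - s n" if "n \<le> m" for n m
    using that
  proof (induction m rule: dec_induct)
    case (step m)
    have "\<pi> ^ n dvd \<pi> ^ m"
      using step(1) by (rule le_imp_power_dvd)
    also have "\<pi> ^ m dvd s (Suc m) - s m"
      by (rule assms)
    finally have "\<pi> ^ n dvd (s (Suc m) - s m) + (s m - s n)"
      using step(3) by (rule dvd_add)
    then show ?case
      by simp
  qed simp
  have "\<exists>N. \<forall>i\<ge>N. \<forall>j\<ge>N. s i - s j \<in> ideal_power \<mm> n" for n
  proof (intro exI[of _ n] allI impI)
    fix i j assume "n \<le> i" "n \<le> j"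
    from dvd_diff[OF steps[OF this(1)] steps[OF this(2)]] show "s i - s j \<in> ideal_power \<mm> n"
      by (simp add: ideal_power_maximal)
  qed
  then have "\<exists>l. \<forall>n. \<exists>N. \<forall>i\<ge>N. s i - l \<in> ideal_power \<mm> n"
    by (intro complete allI)
  then obtain l where l: "\<forall>n. \<exists>N. \<forall>i\<ge>N. \<pi> ^ n dvd s i - l"
    by (auto simp: ideal_power_maximal)
  have "\<pi> ^ n dvd l - s n" for n
  proof -
    obtain N where "\<pi> ^ n dvd s (max N n) - l"
      using l by (meson max.cobounded1)
    moreover have "\<pi> ^ n dvd s (max N n) - s n"
      by (rule steps) simp
    ultimately show ?thesis
      using dvd_diff[of "\<pi> ^ n" "s (max N n) - s n" "s (max N n) - l"] by simp
  qed
  with that show thesis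
    by blast
qed

lemma Hensel:
  assumes "\<pi> dvd poly f a" "\<not> \<pi> dvd poly (pderiv f) a"
  obtains l where "poly f l = 0" "\<pi> dvd l - a"
proof -
  obtain h where h: "poly (pderiv f) a * h = 1"
    using unit_inverse[OF assms(2)] by blast
  define s where "s n = ((\<lambda>t. t - poly f t * h) ^^ n) a" for n
  have s_0: "s 0 = a" and s_Suc: "s (Suc n) = s n - poly f (s n) * h" for n
    by (simp_all add: s_def)
  have s: "\<pi> dvd s n - a \<and> \<pi> ^ Suc n dvd poly f (s n)" for n
  proof (induction n)
    case (Suc n)
    then show ?case
      unfolding s_Suc using Newton_step[OF h] by blast
  qed (use assms(1) in \<open>simp add: s_0\<close>)
  then have approx: "\<pi> ^ n dvd poly f (s n)" for n
    using dvd_trans le_imp_power_dvd[of n "Suc n"] by (meson le_SucI order_refl)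
  then have "\<pi> ^ n dvd s (Suc n) - s n" for n
    by (simp add: s_Suc)
  then obtain l where l: "\<And>n. \<pi> ^ n dvd l - s n"
    by (rule limit_of_uniformizer_steps) blast
  have "\<pi> ^ n dvd poly f l" for n
  proof -
    have "\<pi> ^ n dvd poly f l - poly f (s n)"
      using l diff_dvd_poly_diff by (rule dvd_trans)
    from dvd_add[OF this approx] show ?thesis
      by simp
  qed
  then have "poly f l = 0"
    by (rule eq_0_if_all_powers_dvd)
  moreover have "\<pi> dvd l - a"
    using dvd_add[of \<pi> "l - s 1" "s 1 - a"] l[of 1] s[of 1] by simp
  ultimately show thesis
    by (rule that)
qed

end

locale odd_complete_dvr = complete_discrete_valuation_ring \<mm> + odd_residue_dvr \<mm>
  for \<mm> :: "'r::idom set"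
begin

lemma unit_residue_square_imp_square:
  assumes u: "\<not> \<pi> dvd u" and "residue_square u"
  obtains s where "u = s\<^sup>2"
proof -
  obtain t where t: "\<pi> dvd u - t\<^sup>2"
    using assms(2) unfolding residue_square_def by blast
  then have "\<not> \<pi> dvd t"
    using u uniformizer_dvd_cong[OF t] by (simp add: uniformizer_dvd_square_iff)
  then have "\<not> \<pi> dvd 2 * t"
    using not_uniformizer_dvd_2 by (simp add: uniformizer_dvd_mult_iff)
  moreover define f where "f = [:- u, 0, 1:]"
  then have f: "poly f x = x\<^sup>2 - u" "poly (pderiv f) x = 2 * x" for x
    by (simp_all add: pderiv_pCons power2_eq_square)
  moreover have "\<pi> dvd t\<^sup>2 - u"
    using t by (subst dvd_diff_swap)
  ultimately obtain l where "poly f l = 0"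
    using Hensel[of f t] by metis
  with f(1)[of l] show thesis
    by (intro that[of l]) simp
qed

lemma same_class_units_differ_by_square:
  assumes "\<not> \<pi> dvd u" "\<not> \<pi> dvd v" "residue_square u \<longleftrightarrow> residue_square v"
  obtains s where "u = v * s\<^sup>2"
proof -
  have "residue_square (u * v)"
    using assms residue_square_mult residue_square_mult_nonsquares by blast
  moreover have "\<not> \<pi> dvd u * v"
    using assms by (simp add: uniformizer_dvd_mult_iff)
  ultimately obtain r where r: "u * v = r\<^sup>2"
    using unit_residue_square_imp_square[of "u * v"] by blast
  obtain w where w: "v * w = 1"
    using unit_inverse[OF assms(2)] by blast
  have "v * (w * r)\<^sup>2 = u * (v * w) * (v * w)"
    by (simp add: power_mult_distrib r[symmetric]) (simp add: power2_eq_square mult_ac)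
  then show thesis
    by (intro that[of "w * r"]) (simp add: w)
qed

end

section \<open>Diagonal forms\<close>

definition diag_form :: "'i set \<Rightarrow> ('i \<Rightarrow> 'a::comm_ring_1) \<Rightarrow> ('i \<Rightarrow> 'a) \<Rightarrow> 'a" where
  "diag_form I c z = (\<Sum>i\<in>I. c i * (z i)\<^sup>2)"

definition diag_anisotropic :: "'i set \<Rightarrow> ('i \<Rightarrow> 'a::comm_ring_1) \<Rightarrow> bool" where
  "diag_anisotropic I c \<longleftrightarrow> (\<forall>z. diag_form I c z = 0 \<longrightarrow> (\<forall>i\<in>I. z i = 0))"

lemma diag_form_cong:
  assumes "\<And>i. i \<in> I \<Longrightarrow> b i = c i" "\<And>i. i \<in> I \<Longrightarrow> y i = z i"
  shows "diag_form I b y = diag_form I c z"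
  unfolding diag_form_def using assms by (intro sum.cong) auto

lemma diag_form_scale: "diag_form I c (\<lambda>i. s * z i) = s\<^sup>2 * diag_form I c z"
  by (simp add: diag_form_def sum_distrib_left power_mult_distrib algebra_simps)

lemma diag_form_common_factor:
  assumes "\<And>i. i \<in> I \<Longrightarrow> s dvd z i"
  obtains y where "\<And>i. i \<in> I \<Longrightarrow> z i = s * y i" "diag_form I c z = s\<^sup>2 * diag_form I c y"
proof -
  have "\<forall>i\<in>I. \<exists>y. z i = s * y"
    using assms by (meson dvdE)
  then obtain y where y: "\<And>i. i \<in> I \<Longrightarrow> z i = s * y i"
    by metis
  then have "diag_form I c z = diag_form I c (\<lambda>i. s * y i)"
    by (intro diag_form_cong) auto
  then show thesis
    using y by (intro that[of y]) (auto simp: diag_form_scale)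
qed

lemma diag_form_extend_by_zero:
  assumes "finite I" "J \<subseteq> I"
  shows "diag_form I c (\<lambda>i. if i \<in> J then z i else 0) = diag_form J c z"
  unfolding diag_form_def using assms by (intro sum.mono_neutral_cong_right) auto

lemma diag_anisotropic_subset:
  assumes "diag_anisotropic I c" "finite I" "J \<subseteq> I"
  shows "diag_anisotropic J c"
  unfolding diag_anisotropic_def
proof (intro allI impI ballI)
  fix z i assume "diag_form J c z = 0" "i \<in> J"
  then have "diag_form I c (\<lambda>i. if i \<in> J then z i else 0) = 0"
    using assms(2,3) by (simp add: diag_form_extend_by_zero)
  then have "(if i \<in> J then z i else 0) = 0"
    using assms(1,3) \<open>i \<in> J\<close> unfolding diag_anisotropic_def by blast
  with \<open>i \<in> J\<close> show "z i = 0"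
    by simp
qed

lemma diag_anisotropic_nonzero:
  assumes "diag_anisotropic I c" "i \<in> I"
  shows "c i \<noteq> 0"
proof
  assume "c i = 0"
  then have "diag_form I c (\<lambda>j. if j = i then 1 else 0) = 0"
    unfolding diag_form_def by (intro sum.neutral) auto
  with assms show False
    unfolding diag_anisotropic_def by fastforce
qed

context discrete_valuation_ring
begin

definition residually_anisotropic :: "'i set \<Rightarrow> ('i \<Rightarrow> 'r) \<Rightarrow> bool" where
  "residually_anisotropic I u \<longleftrightarrow> (\<forall>z. \<pi> dvd diag_form I u z \<longrightarrow> (\<forall>i\<in>I. \<pi> dvd z i))"

lemma residually_anisotropicD:
  "residually_anisotropic I u \<Longrightarrow> \<pi> dvd diag_form I u z \<Longrightarrow> i \<in> I \<Longrightarrow> \<pi> dvd z i"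
  unfolding residually_anisotropic_def by blast

lemma residually_anisotropic_subset:
  assumes "residually_anisotropic I u" "finite I" "J \<subseteq> I"
  shows "residually_anisotropic J u"
  unfolding residually_anisotropic_def
proof (intro allI impI ballI)
  fix z i assume "\<pi> dvd diag_form J u z" "i \<in> J"
  then have "\<pi> dvd diag_form I u (\<lambda>i. if i \<in> J then z i else 0)"
    using assms(2,3) by (simp add: diag_form_extend_by_zero)
  then have "\<pi> dvd (if i \<in> J then z i else 0)"
    using residually_anisotropicD[OF assms(1)] assms(3) \<open>i \<in> J\<close> by blast
  with \<open>i \<in> J\<close> show "\<pi> dvd z i"
    by simp
qed

lemma residually_anisotropic_dvd_square:
  assumes "residually_anisotropic I u" "\<pi> dvd diag_form I u z"
  shows "\<pi>\<^sup>2 dvd diag_form I u z"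
proof -
  have "\<And>i. i \<in> I \<Longrightarrow> \<pi> dvd z i"
    using residually_anisotropicD[OF assms] .
  then obtain y where "diag_form I u z = \<pi>\<^sup>2 * diag_form I u y"
    by (rule diag_form_common_factor) blast
  then show ?thesis
    by simp
qed

lemma residually_anisotropic_binary:
  assumes u: "\<not> \<pi> dvd u i" "\<not> \<pi> dvd u j" and nonsquare: "\<not> residue_square (- (u i * u j))"
    and "i \<noteq> j"
  shows "residually_anisotropic {i, j} u"
  unfolding residually_anisotropic_def
proof (intro allI impI)
  fix z assume "\<pi> dvd diag_form {i, j} u z"
  then have z: "\<pi> dvd u i * (z i)\<^sup>2 + u j * (z j)\<^sup>2"
    using \<open>i \<noteq> j\<close> by (simp add: diag_form_def)
  then have "\<pi> dvd u i * (u i * (z i)\<^sup>2 + u j * (z j)\<^sup>2)"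
    by (rule dvd_mult)
  then have "\<pi> dvd - (u i * u j) * (z j)\<^sup>2 - (u i * z i)\<^sup>2"
    by (subst dvd_diff_swap) (simp add: power2_eq_square algebra_simps)
  then have "residue_square (- (u i * u j) * (z j)\<^sup>2)"
    unfolding residue_square_def by blast
  then have z_j: "\<pi> dvd z j"
    using nonsquare residue_square_mult_square_iff by blast
  then have "\<pi> dvd u i * (z i)\<^sup>2"
    using z by (simp add: dvd_add_left_iff uniformizer_dvd_square_iff)
  then have "\<pi> dvd z i"
    using u by (simp add: uniformizer_dvd_mult_iff uniformizer_dvd_square_iff)
  with z_j show "\<forall>k\<in>{i, j}. \<pi> dvd z k"
    by simp
qed

lemma residually_anisotropic_norm_form:
  fixes a :: nat
  assumes \<epsilon>: "\<not> \<pi> dvd \<epsilon>" "\<not> residue_square \<epsilon>" and "k \<le> 2"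
    and u: "\<And>i. i \<in> {a..<a + k} \<Longrightarrow> u i = (if i = a then 1 else - \<epsilon>)"
  shows "residually_anisotropic {a..<a + k} u"
proof -
  let ?u = "\<lambda>i. if i = a then 1 else - \<epsilon>"
  have "residually_anisotropic {a, Suc a} ?u"
    by (rule residually_anisotropic_binary) (use \<epsilon> not_uniformizer_dvd_1 in auto)
  then have "residually_anisotropic {a..<a + k} ?u"
    by (rule residually_anisotropic_subset) (use \<open>k \<le> 2\<close> in auto)
  moreover have "diag_form {a..<a + k} u z = diag_form {a..<a + k} ?u z" for z
    by (rule diag_form_cong) (simp_all add: u)
  ultimately show ?thesis
    by (simp add: residually_anisotropic_def)
qed

definition unit_classes :: "'i set \<Rightarrow> ('i \<Rightarrow> 'r) \<Rightarrow> bool set" where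
  "unit_classes I u = {residue_square (diag_form I u z) | z. \<not> \<pi> dvd diag_form I u z}"

end

context odd_residue_dvr
begin

lemma card_le_2_if_residually_anisotropic:
  assumes "residually_anisotropic I u" "finite I" and u: "\<And>i. i \<in> I \<Longrightarrow> \<not> \<pi> dvd u i"
  shows "card I \<le> 2"
proof (rule ccontr)
  assume "\<not> card I \<le> 2"
  then have "3 \<le> card I"
    by simp
  then obtain J where "J \<subseteq> I" "card J = 3"
    by (meson obtain_subset_with_card_n)
  then obtain i j k where ijk: "{i, j, k} \<subseteq> I" "i \<noteq> j" "i \<noteq> k" "j \<noteq> k"
    by (auto simp: card_3_iff)
  then obtain x y where xy: "\<pi> dvd - u k - (u i * x\<^sup>2 + u j * y\<^sup>2)"
    using binary_unit_form_universal[OF u u, of i j] by blast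
  define z where "z = (\<lambda>_. 1)(i := x, j := y)"
  have "diag_form {i, j, k} u z = - (- u k - (u i * x\<^sup>2 + u j * y\<^sup>2))"
    using ijk by (simp add: diag_form_def z_def)
  then have "\<pi> dvd diag_form {i, j, k} u z"
    using xy by (simp only: dvd_minus_iff)
  with residually_anisotropic_subset[OF assms(1,2) ijk(1)] have "\<pi> dvd z k"
    by (rule residually_anisotropicD) simp
  with ijk not_uniformizer_dvd_1 show False
    by (simp add: z_def)
qed

lemma unit_classes_singleton:
  assumes "\<not> \<pi> dvd u i"
  shows "unit_classes {i} u = {residue_square (u i)}"
proof (intro equalityI subsetI)
  show "b \<in> {residue_square (u i)}" if "b \<in> unit_classes {i} u" for b
    using that
    by (auto simp: unit_classes_def diag_form_def uniformizer_dvd_mult_iff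
        uniformizer_dvd_square_iff residue_square_mult_square_iff)
  have "diag_form {i} u (\<lambda>_. 1) = u i"
    by (simp add: diag_form_def)
  with assms show "b \<in> unit_classes {i} u" if "b \<in> {residue_square (u i)}" for b
    using that unfolding unit_classes_def by (intro CollectI exI[of _ "\<lambda>_. 1"]) simp
qed

lemma unit_classes_pair:
  assumes "\<not> \<pi> dvd u i" "\<not> \<pi> dvd u j" "i \<noteq> j"
  shows "unit_classes {i, j} u = UNIV"
proof -
  have "b \<in> unit_classes {i, j} u" for b
  proof -
    obtain w where w: "\<not> \<pi> dvd w" "residue_square w = b"
      using ex_unit_in_class by blast
    obtain x y where "\<pi> dvd w - (u i * x\<^sup>2 + u j * y\<^sup>2)"
      using binary_unit_form_universal[OF assms(1,2)] .
    then have cong: "\<pi> dvd w - diag_form {i, j} u ((\<lambda>_. x)(j := y))"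
      using assms(3) by (simp add: diag_form_def)
    show ?thesis
      unfolding unit_classes_def
      using w uniformizer_dvd_cong[OF cong] residue_square_cong[OF cong]
      by (intro CollectI exI[of _ "(\<lambda>_. x)(j := y)"]) simp
  qed
  then show ?thesis
    by blast
qed

lemma card_unit_classes:
  assumes "finite I" "card I \<le> 2" and u: "\<And>i. i \<in> I \<Longrightarrow> \<not> \<pi> dvd u i"
  shows "card (unit_classes I u) = card I"
proof -
  consider "card I = 0" | "card I = 1" | "card I = 2"
    using assms(2) by linarith
  then show ?thesis
  proof cases
    case 1
    then have "I = {}"
      using assms(1) by simp
    then show ?thesis
      by (simp add: unit_classes_def diag_form_def)
  next
    case 2
    then obtain i where "I = {i}"
      by (auto simp: card_1_singleton_iff)
    with u show ?thesis
      by (simp add: unit_classes_singleton)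
  next
    case 3
    then obtain i j where "I = {i, j}" "i \<noteq> j"
      by (auto simp: card_2_iff)
    with u show ?thesis
      by (simp add: unit_classes_pair)
  qed
qed

end

text \<open>A nontrivial zero modulo \<open>\<pi>\<close> lifts: keep all coordinates but one unit coordinate, and solve
  for that one by Hensel's lemma.\<close>

lemma (in odd_complete_dvr) diag_anisotropic_imp_residually_anisotropic:
  assumes "diag_anisotropic I u" "finite I" and u: "\<And>i. i \<in> I \<Longrightarrow> \<not> \<pi> dvd u i"
  shows "residually_anisotropic I u"
  unfolding residually_anisotropic_def
proof (intro allI impI ballI, rule ccontr)
  fix z i assume z: "\<pi> dvd diag_form I u z" and i: "i \<in> I" and z_i: "\<not> \<pi> dvd z i"
  define c where "c = diag_form (I - {i}) u z"
  have split: "diag_form I u y = u i * (y i)\<^sup>2 + diag_form (I - {i}) u y" for y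
    unfolding diag_form_def using assms(2) i by (rule sum.remove)
  have "- c - u i * (z i)\<^sup>2 = - diag_form I u z"
    by (simp add: split c_def)
  then have cong: "\<pi> dvd - c - u i * (z i)\<^sup>2"
    using z by (simp only: dvd_minus_iff)
  have not_dvd: "\<not> \<pi> dvd - c"
    using uniformizer_dvd_cong[OF cong] u[OF i] z_i
    by (simp add: uniformizer_dvd_mult_iff uniformizer_dvd_square_iff)
  moreover have "residue_square (- c) \<longleftrightarrow> residue_square (u i)"
    using residue_square_cong[OF cong] z_i by (simp add: residue_square_mult_square_iff)
  ultimately obtain s where s: "- c = u i * s\<^sup>2"
    using same_class_units_differ_by_square[OF _ u[OF i]] by blast
  have "diag_form (I - {i}) u (z(i := s)) = c"
    unfolding c_def by (intro diag_form_cong) auto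
  then have "diag_form I u (z(i := s)) = u i * s\<^sup>2 + c"
    by (simp add: split)
  also have "\<dots> = 0"
    by (simp flip: s)
  finally have "s = 0"
    using assms(1) i unfolding diag_anisotropic_def by fastforce
  with s not_dvd show False
    by simp
qed

section \<open>Diagonalisation over a field\<close>

lemma qf_Suc:
  "qf (Suc n) a x = qf n a x + (\<Sum>i<n. a i n * x i) * x n + a n n * (x n)\<^sup>2"
proof -
  have "(\<Sum>i<n. \<Sum>j\<in>{i..<Suc n}. a i j * x i * x j) =
      (\<Sum>i<n. (\<Sum>j\<in>{i..<n}. a i j * x i * x j) + a i n * x i * x n)"
    by (intro sum.cong) auto
  then show ?thesis
    by (simp add: qf_def sum.distrib sum_distrib_right power2_eq_square mult.assoc)
qed

lemma qf_cong: "(\<And>i. i < n \<Longrightarrow> x i = y i) \<Longrightarrow> qf n a x = qf n a y"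
  unfolding qf_def by (intro sum.cong) auto

lemma qf_scale: "qf n a (\<lambda>i. s * x i) = s\<^sup>2 * qf n a x"
  unfolding qf_def sum_distrib_left
  by (intro sum.cong refl) (simp add: power2_eq_square algebra_simps)

lemma qf_diff_scale: "qf n (\<lambda>i j. a i j - c * b i j) x = qf n a x - c * qf n b x"
  unfolding qf_def sum_distrib_left sum_subtractf[symmetric]
  by (intro sum.cong refl) (simp add: algebra_simps)

lemma qf_diagonal: "qf n (\<lambda>i j. if i = j then d i else 0) x = diag_form {..<n} d x"
proof (induction n)
  case (Suc n)
  have "(\<Sum>i<n. (if i = n then d i else 0) * x i) = 0"
    by (rule sum.neutral) auto
  with Suc show ?case
    by (simp add: qf_Suc diag_form_def)
qed (simp add: qf_def diag_form_def)

lemma qf_last_unit_vector: "qf (Suc n) a (\<lambda>i. if i = n then 1 else 0) = a n n"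
proof -
  have "qf n a (\<lambda>i. if i = n then 1 else 0) = 0"
    unfolding qf_def by (intro sum.neutral ballI) auto
  then show ?thesis
    by (simp add: qf_Suc)
qed

lemma square_of_linear_form:
  "(\<Sum>i<n. l i * x i)\<^sup>2 = qf n (\<lambda>i j. if i = j then (l i)\<^sup>2 else 2 * l i * l j) x"
proof (induction n)
  case (Suc n)
  have "(\<Sum>i<n. (if i = n then (l i)\<^sup>2 else 2 * l i * l n) * x i) = (\<Sum>i<n. 2 * l n * (l i * x i))"
    by (rule sum.cong) (auto simp: algebra_simps)
  also have "\<dots> = 2 * l n * (\<Sum>i<n. l i * x i)"
    by (simp add: sum_distrib_left)
  finally show ?case
    using Suc by (simp add: qf_Suc power2_sum power_mult_distrib algebra_simps)
qed (simp add: qf_def)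

lemma complete_square:
  fixes a :: "nat \<Rightarrow> nat \<Rightarrow> 'a::field"
  assumes two: "(2::'a) \<noteq> 0" and a_nn: "a n n \<noteq> 0"
  obtains b where
    "\<And>x. qf (Suc n) a x = qf n b x + a n n * (x n + (\<Sum>i<n. a i n / (2 * a n n) * x i))\<^sup>2"
proof (rule that)
  fix x
  let ?b = "\<lambda>i j. a i j - 1 / (4 * a n n) * (if i = j then (a i n)\<^sup>2 else 2 * a i n * a j n)"
  define L where "L = (\<Sum>i<n. a i n * x i)"
  have four: "(4::'a) \<noteq> 0"
    using two by (metis mult_2 mult_eq_0_iff numeral_Bit0)
  have "qf n ?b x = qf n a x - 1 / (4 * a n n) * L\<^sup>2"
    unfolding qf_diff_scale L_def square_of_linear_form ..
  moreover have "(\<Sum>i<n. a i n / (2 * a n n) * x i) = L / (2 * a n n)"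
    by (simp add: L_def sum_divide_distrib)
  moreover have "a n n * (x n + L / (2 * a n n))\<^sup>2 =
      a n n * (x n)\<^sup>2 + L * x n + 1 / (4 * a n n) * L\<^sup>2"
    using two four a_nn by (simp add: field_simps power2_eq_square)
  ultimately show "qf (Suc n) a x = qf n ?b x + a n n * (x n + (\<Sum>i<n. a i n / (2 * a n n) * x i))\<^sup>2"
    unfolding qf_Suc L_def[symmetric] by simp
qed

definition unitriangular :: "(nat \<Rightarrow> nat \<Rightarrow> 'a::comm_ring_1) \<Rightarrow> (nat \<Rightarrow> 'a) \<Rightarrow> nat \<Rightarrow> 'a" where
  "unitriangular l x i = x i + (\<Sum>j<i. l i j * x j)"

lemma unitriangular_cong:
  assumes "\<And>j. j \<le> i \<Longrightarrow> x j = y j"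
  shows "unitriangular l x i = unitriangular l y i"
  unfolding unitriangular_def using assms by simp

lemma unitriangular_surj: "\<exists>x. \<forall>i<n. unitriangular l x i = y i"
proof (induction n)
  case (Suc n)
  then obtain x where x: "\<And>i. i < n \<Longrightarrow> unitriangular l x i = y i"
    by blast
  define x' where "x' = x(n := y n - (\<Sum>j<n. l n j * x j))"
  have "unitriangular l x' i = y i" if "i < n" for i
    using x[OF that] that unitriangular_cong[of i x' x l] by (simp add: x'_def)
  moreover have "unitriangular l x' n = y n"
    by (simp add: unitriangular_def x'_def)
  ultimately show ?case
    using less_Suc_eq by metis
qed simp

lemma diag_form_unitriangular_surj:
  "\<exists>x. diag_form {..<n} c (unitriangular l x) = diag_form {..<n} c z \<and>
     (\<forall>i<n. unitriangular l x i = z i)"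
proof -
  obtain x where "\<forall>i<n. unitriangular l x i = z i"
    using unitriangular_surj by blast
  then show ?thesis
    by (intro exI[of _ x] conjI diag_form_cong) auto
qed

lemma anisotropic_diagonalisation:
  fixes a :: "nat \<Rightarrow> nat \<Rightarrow> 'a::field"
  assumes two: "(2::'a) \<noteq> 0" and aniso: "\<And>x. qf n a x = 0 \<Longrightarrow> \<forall>i<n. x i = 0"
  shows "\<exists>c l. \<forall>x. qf n a x = diag_form {..<n} c (unitriangular l x)"
  using aniso
proof (induction n arbitrary: a)
  case (Suc n)
  have a_nn: "a n n \<noteq> 0"
    using Suc.prems[OF trans[OF qf_last_unit_vector], THEN spec[of _ n]] by auto
  define m where "m j = a j n / (2 * a n n)" for j
  obtain b where b: "\<And>x. qf (Suc n) a x = qf n b x + a n n * (x n + (\<Sum>i<n. m i * x i))\<^sup>2"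
    unfolding m_def using complete_square[where a = a and n = n, OF two a_nn] by blast
  have "\<forall>i<n. x i = 0" if "qf n b x = 0" for x
  proof -
    define x' where "x' = x(n := - (\<Sum>i<n. m i * x i))"
    have "qf n b x' = 0"
      using that qf_cong[of n x' x b] by (simp add: x'_def)
    then have "qf (Suc n) a x' = 0"
      by (simp add: b x'_def)
    then have "\<forall>i<Suc n. x' i = 0"
      by (rule Suc.prems)
    then show ?thesis
      by (simp add: x'_def less_Suc_eq)
  qed
  then obtain c l where cl: "\<And>x. qf n b x = diag_form {..<n} c (unitriangular l x)"
    using Suc.IH[of b] by blast
  have "qf (Suc n) a x = diag_form {..<Suc n} (c(n := a n n)) (unitriangular (l(n := m)) x)" for x
  proof -
    have "diag_form {..<n} c (unitriangular l x) =
        diag_form {..<n} (c(n := a n n)) (unitriangular (l(n := m)) x)"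
      by (intro diag_form_cong) (auto simp: unitriangular_def)
    then show ?thesis
      by (simp add: b cl diag_form_def unitriangular_def)
  qed
  then show ?case
    by blast
qed (simp add: qf_def diag_form_def)

corollary anisotropic_range_diag_form:
  fixes a :: "nat \<Rightarrow> nat \<Rightarrow> 'a::field"
  assumes "(2::'a) \<noteq> 0" and aniso: "\<And>x. qf n a x = 0 \<Longrightarrow> \<forall>i<n. x i = 0"
  obtains c where "range (qf n a) = range (diag_form {..<n} c)" "diag_anisotropic {..<n} c"
proof -
  obtain c l where qf: "\<And>x. qf n a x = diag_form {..<n} c (unitriangular l x)"
    using anisotropic_diagonalisation[OF assms] by blast
  have preimage: "\<exists>x. qf n a x = diag_form {..<n} c z \<and> (\<forall>i<n. unitriangular l x i = z i)" for z
    unfolding qf by (rule diag_form_unitriangular_surj)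
  have "range (qf n a) = range (diag_form {..<n} c)"
  proof (intro equalityI subsetI)
    fix y assume "y \<in> range (qf n a)"
    then show "y \<in> range (diag_form {..<n} c)"
      using qf by auto
  next
    fix y assume "y \<in> range (diag_form {..<n} c)"
    then obtain z where "y = diag_form {..<n} c z"
      by blast
    then obtain x where "y = qf n a x"
      using preimage[of z] by metis
    then show "y \<in> range (qf n a)"
      by blast
  qed
  moreover have "diag_anisotropic {..<n} c"
    unfolding diag_anisotropic_def
  proof (intro allI impI ballI)
    fix z i assume "diag_form {..<n} c z = 0" "i \<in> {..<n}"
    then obtain x where "qf n a x = 0" and z: "unitriangular l x i = z i"
      using preimage[of z] by (metis lessThan_iff)
    then have "\<forall>j<n. x j = 0"
      using aniso by blast
    with z \<open>i \<in> {..<n}\<close> show "z i = 0"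
      by (simp add: unitriangular_def)
  qed
  ultimately show thesis
    by (rule that)
qed

lemma diag_form_absorb_squares:
  "diag_form I (\<lambda>i. c i * (t i)\<^sup>2) z = diag_form I c (\<lambda>i. t i * z i)"
  by (simp add: diag_form_def power_mult_distrib mult.assoc)

lemma diag_form_divide_squares:
  fixes c t :: "'i \<Rightarrow> 'a::field"
  assumes "\<And>i. i \<in> I \<Longrightarrow> t i \<noteq> 0"
  shows "diag_form I (\<lambda>i. c i * (t i)\<^sup>2) (\<lambda>i. z i / t i) = diag_form I c z"
  unfolding diag_form_absorb_squares using assms by (intro diag_form_cong) auto

lemma range_diag_form_absorb_squares:
  fixes c t :: "'i \<Rightarrow> 'a::field"
  assumes "\<And>i. i \<in> I \<Longrightarrow> t i \<noteq> 0"
  shows "range (diag_form I (\<lambda>i. c i * (t i)\<^sup>2)) = range (diag_form I c)"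
proof (intro equalityI image_subsetI)
  fix z
  show "diag_form I (\<lambda>i. c i * (t i)\<^sup>2) z \<in> range (diag_form I c)"
    unfolding diag_form_absorb_squares by (rule rangeI)
  have "diag_form I c z = diag_form I (\<lambda>i. c i * (t i)\<^sup>2) (\<lambda>i. z i / t i)"
    using assms by (rule diag_form_divide_squares[symmetric])
  then show "diag_form I c z \<in> range (diag_form I (\<lambda>i. c i * (t i)\<^sup>2))"
    by (simp only: rangeI)
qed

lemma diag_anisotropic_absorb_squares:
  fixes c t :: "'i \<Rightarrow> 'a::field"
  assumes "\<And>i. i \<in> I \<Longrightarrow> t i \<noteq> 0" "diag_anisotropic I (\<lambda>i. c i * (t i)\<^sup>2)"
  shows "diag_anisotropic I c"
  unfolding diag_anisotropic_def
proof (intro allI impI ballI)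
  fix z i assume "diag_form I c z = 0" "i \<in> I"
  then have "diag_form I (\<lambda>i. c i * (t i)\<^sup>2) (\<lambda>i. z i / t i) = 0"
    using diag_form_divide_squares[where c = c and t = t and z = z, OF assms(1)] by simp
  then have "z i / t i = 0"
    using assms(2) \<open>i \<in> I\<close> unfolding diag_anisotropic_def by blast
  with assms(1) \<open>i \<in> I\<close> show "z i = 0"
    by simp
qed

section \<open>Clearing denominators\<close>

lemma to_fract_power: "to_fract (x ^ k) = to_fract x ^ k"
  by (induction k) simp_all

lemma qf_frac_to_fract: "qf_frac n a (\<lambda>i. to_fract (z i)) = to_fract (qf n a z)"
  by (simp add: qf_frac_def qf_def to_fract_def[symmetric])

lemma diag_form_to_fract:
  "diag_form I (\<lambda>i. to_fract (c i)) (\<lambda>i. to_fract (z i)) = to_fract (diag_form I c z)"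
  by (simp add: diag_form_def to_fract_power)

lemma common_denominator:
  fixes w :: "'i \<Rightarrow> 'r::idom fract"
  assumes "finite I"
  shows "\<exists>s z. s \<noteq> 0 \<and> (\<forall>i\<in>I. to_fract s * w i = to_fract (z i))"
  using assms
proof (induction I)
  case (insert k I)
  then obtain s z where s: "s \<noteq> 0" "\<And>i. i \<in> I \<Longrightarrow> to_fract s * w i = to_fract (z i)"
    by blast
  obtain p r where pr: "w k = to_fract p / to_fract r" "r \<noteq> 0"
    by (cases "w k") (auto simp: Fract_conv_to_fract)
  have "to_fract (r * s) * w i = to_fract (((\<lambda>j. r * z j)(k := s * p)) i)" if "i \<in> insert k I" for i
  proof (cases "i = k")
    case True
    with pr show ?thesis
      by simp
  next
    case False
    with that s(2) show ?thesis
      by (simp add: mult.assoc)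
  qed
  moreover have "r * s \<noteq> 0"
    using s pr by simp
  ultimately show ?case
    by blast
qed (auto intro: exI[of _ 1])

lemma diag_form_clear_denominators:
  assumes "finite I"
  obtains s z where "s \<noteq> 0" "\<And>i. i \<in> I \<Longrightarrow> to_fract s * w i = to_fract (z i)"
    "to_fract (diag_form I c z) = to_fract (s\<^sup>2) * diag_form I (\<lambda>i. to_fract (c i)) w"
proof -
  obtain s z where s: "s \<noteq> 0" "\<And>i. i \<in> I \<Longrightarrow> to_fract s * w i = to_fract (z i)"
    using common_denominator[OF assms] by blast
  have "to_fract (diag_form I c z) = diag_form I (\<lambda>i. to_fract (c i)) (\<lambda>i. to_fract s * w i)"
    unfolding diag_form_to_fract[symmetric] by (intro diag_form_cong) (auto simp: s(2))
  then have "to_fract (diag_form I c z) = to_fract (s\<^sup>2) * diag_form I (\<lambda>i. to_fract (c i)) w"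
    by (simp add: diag_form_scale to_fract_power)
  with s show thesis
    by (rule that)
qed

lemma diag_anisotropic_to_fract_iff:
  assumes "finite I"
  shows "diag_anisotropic I (\<lambda>i. to_fract (c i)) \<longleftrightarrow> diag_anisotropic I c"
proof
  show "diag_anisotropic I c" if "diag_anisotropic I (\<lambda>i. to_fract (c i))"
    using that unfolding diag_anisotropic_def by (metis diag_form_to_fract to_fract_eq_0_iff)
  assume aniso: "diag_anisotropic I c"
  show "diag_anisotropic I (\<lambda>i. to_fract (c i))"
    unfolding diag_anisotropic_def
  proof (intro allI impI ballI)
    fix w i assume w: "diag_form I (\<lambda>i. to_fract (c i)) w = 0" and i: "i \<in> I"
    obtain s z where s: "s \<noteq> 0" "\<And>i. i \<in> I \<Longrightarrow> to_fract s * w i = to_fract (z i)"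
      and "to_fract (diag_form I c z) = to_fract (s\<^sup>2) * diag_form I (\<lambda>i. to_fract (c i)) w"
      by (rule diag_form_clear_denominators[OF assms, of w c]) blast
    then have "diag_form I c z = 0"
      using w by simp
    then have "z i = 0"
      using aniso i unfolding diag_anisotropic_def by blast
    with s i show "w i = 0"
      by (metis mult_eq_0_iff to_fract_eq_0_iff)
  qed
qed

lemma to_fract_in_range_diag_form_iff:
  assumes "finite I"
  shows "to_fract x \<in> range (diag_form I (\<lambda>i. to_fract (c i))) \<longleftrightarrow>
    (\<exists>s z. s \<noteq> 0 \<and> s\<^sup>2 * x = diag_form I c z)"
proof
  assume "to_fract x \<in> range (diag_form I (\<lambda>i. to_fract (c i)))"
  then obtain w where w: "to_fract x = diag_form I (\<lambda>i. to_fract (c i)) w"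
    by blast
  obtain s z where "s \<noteq> 0"
    "to_fract (diag_form I c z) = to_fract (s\<^sup>2) * diag_form I (\<lambda>i. to_fract (c i)) w"
    by (rule diag_form_clear_denominators[OF assms, of w c]) blast
  then have "to_fract (s\<^sup>2 * x) = to_fract (diag_form I c z)"
    by (simp only: to_fract_mult w)
  with \<open>s \<noteq> 0\<close> show "\<exists>s z. s \<noteq> 0 \<and> s\<^sup>2 * x = diag_form I c z"
    by (auto simp only: to_fract_eq_iff)
next
  assume "\<exists>s z. s \<noteq> 0 \<and> s\<^sup>2 * x = diag_form I c z"
  then obtain s z where s: "s \<noteq> 0" "s\<^sup>2 * x = diag_form I c z"
    by blast
  have "diag_form I (\<lambda>i. to_fract (c i)) (\<lambda>i. inverse (to_fract s) * to_fract (z i)) =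
      (inverse (to_fract s))\<^sup>2 * to_fract (s\<^sup>2 * x)"
    unfolding diag_form_scale diag_form_to_fract s(2) ..
  also have "\<dots> = to_fract x"
    using s(1) by (simp add: to_fract_power power_inverse field_simps)
  finally show "to_fract x \<in> range (diag_form I (\<lambda>i. to_fract (c i)))"
    by (metis rangeI)
qed

lemma anisotropic_imp_nondegenerate:
  fixes a :: "nat \<Rightarrow> nat \<Rightarrow> 'r::idom"
  assumes "(2::'r fract) \<noteq> 0" "anisotropic n a"
  shows "nondegenerate n a"
  unfolding nondegenerate_def
proof (intro allI impI)
  fix u i assume u: "\<forall>w. qf_polar n a u w = 0" and i: "i < n"
  have "(\<lambda>i. u i + u i) = (\<lambda>i. 2 * u i)"
    by (simp only: mult_2)
  then have "qf_polar n a u u = 2 * qf_frac n a u"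
    unfolding qf_polar_def qf_frac_def by (simp add: qf_scale power2_eq_square)
  with u assms(1) have "qf_frac n a u = 0"
    by simp
  with assms(2) i show "u i = 0"
    unfolding anisotropic_def by blast
qed

lemma ADC_iff_range: "ADC n a \<longleftrightarrow> range (qf n a) = {x. to_fract x \<in> range (qf_frac n a)}"
proof -
  have "range (qf n a) \<subseteq> {x. to_fract x \<in> range (qf_frac n a)}"
    by (auto simp: qf_frac_to_fract[symmetric])
  then show ?thesis
    unfolding ADC_def to_fract_def[symmetric] by blast
qed

lemma (in odd_residue_dvr) two_fract_neq_0: "(2::'r fract) \<noteq> 0"
proof -
  have "(2::'r) \<noteq> 0"
    using not_uniformizer_dvd_2 by auto
  moreover have "(2::'r fract) = to_fract 2"
    by (metis one_add_one to_fract_1 to_fract_add)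
  ultimately show ?thesis
    by (metis to_fract_eq_0_iff)
qed

section \<open>Normalised diagonal forms and their values\<close>

context discrete_valuation_ring
begin

definition sphere_class :: "nat \<Rightarrow> bool \<Rightarrow> 'r set" where
  "sphere_class k b = {w * \<pi> ^ k | w. \<not> \<pi> dvd w \<and> residue_square w = b}"

definition square_class :: "nat \<Rightarrow> bool \<Rightarrow> 'r set" where
  "square_class p b = (\<Union>k. sphere_class (2 * k + p) b)"

lemma sphere_class_disjoint:
  assumes "x \<in> sphere_class k b" "x \<in> sphere_class k' b'"
  shows "k = k'" "b = b'"
proof -
  obtain w w' where "x = w * \<pi> ^ k" "x = w' * \<pi> ^ k'" "\<not> \<pi> dvd w" "\<not> \<pi> dvd w'"
    and b: "residue_square w = b" "residue_square w' = b'"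
    using assms unfolding sphere_class_def by blast
  then have "k = k'" "w = w'"
    using uniformizer_factorization_unique[of w k w' k'] by simp_all
  with b show "k = k'" "b = b'"
    by simp_all
qed

lemma square_class_disjoint:
  assumes "x \<in> square_class p b" "x \<in> square_class p' b'" "p < 2" "p' < 2"
  shows "p = p'" "b = b'"
proof -
  obtain k k' where k: "x \<in> sphere_class (2 * k + p) b" "x \<in> sphere_class (2 * k' + p') b'"
    using assms(1,2) unfolding square_class_def by blast
  then have "2 * k + p = 2 * k' + p'"
    by (rule sphere_class_disjoint)
  with assms(3,4) show "p = p'"
    by presburger
  show "b = b'"
    using k by (rule sphere_class_disjoint)
qed

lemma disjoint_family_square_classes:
  "disjoint_family_on (\<lambda>(p, b). square_class p b) ({..<2} \<times> UNIV)"
  unfolding disjoint_family_on_def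
proof (intro ballI impI, rule ccontr)
  fix c c' :: "nat \<times> bool"
  assume c: "c \<in> {..<2} \<times> UNIV" "c' \<in> {..<2} \<times> UNIV" "c \<noteq> c'"
    and "(case c of (p, b) \<Rightarrow> square_class p b) \<inter> (case c' of (p, b) \<Rightarrow> square_class p b) \<noteq> {}"
  then obtain x where "x \<in> square_class (fst c) (snd c)" "x \<in> square_class (fst c') (snd c')"
    by (auto simp: case_prod_unfold)
  with c show False
    using square_class_disjoint[of x "fst c" "snd c" "fst c'" "snd c'"] by (auto simp: prod_eq_iff)
qed

lemma zero_notin_square_class: "0 \<notin> square_class p b"
  using uniformizer_nonzero by (auto simp: square_class_def sphere_class_def)

end

locale normalised_diagonal_form = odd_complete_dvr \<mm> for \<mm> :: "'r::idom set" +
  fixes I :: "'i set" and u :: "'i \<Rightarrow> 'r" and e :: "'i \<Rightarrow> nat"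
  assumes finite_I: "finite I"
    and unit: "\<And>i. i \<in> I \<Longrightarrow> \<not> \<pi> dvd u i"
    and exponent_less_2: "\<And>i. i \<in> I \<Longrightarrow> e i < 2"
    and residually_anisotropic_part: "\<And>p. p < 2 \<Longrightarrow> residually_anisotropic {i \<in> I. e i = p} u"
begin

definition component :: "nat \<Rightarrow> 'i set" where
  "component p = {i \<in> I. e i = p}"

abbreviation form :: "('i \<Rightarrow> 'r) \<Rightarrow> 'r" where
  "form \<equiv> diag_form I (\<lambda>i. u i * \<pi> ^ e i)"

lemma component_subset: "component p \<subseteq> I"
  by (auto simp: component_def)

lemma finite_component: "finite (component p)"
  using component_subset finite_I by (rule finite_subset)

lemma residually_anisotropic_component: "p < 2 \<Longrightarrow> residually_anisotropic (component p) u"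
  unfolding component_def by (rule residually_anisotropic_part)

lemma diag_form_component:
  "diag_form (component p) (\<lambda>i. u i * \<pi> ^ e i) z = \<pi> ^ p * diag_form (component p) u z"
  unfolding diag_form_def sum_distrib_left by (intro sum.cong) (auto simp: component_def)

lemma form_components:
  "form z = diag_form (component 0) u z + \<pi> * diag_form (component 1) u z"
proof -
  have "form z = (\<Sum>p<2. diag_form (component p) (\<lambda>i. u i * \<pi> ^ e i) z)"
    unfolding diag_form_def component_def using exponent_less_2
    by (intro sum.group[symmetric] finite_I) auto
  then show ?thesis
    by (simp add: diag_form_component numeral_2_eq_2)
qed

lemma card_component_sum: "card (component 0) + card (component 1) = card I"
proof -
  have "(\<Sum>p<2. card (component p)) = card I"
    unfolding card_eq_sum component_def using exponent_less_2
    by (intro sum.group finite_I) auto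
  then show ?thesis
    by (simp add: numeral_2_eq_2)
qed

lemma card_component_le: "p < 2 \<Longrightarrow> card (component p) \<le> 2"
  using residually_anisotropic_component finite_component
  by (rule card_le_2_if_residually_anisotropic) (auto simp: component_def unit)

lemma card_unit_classes_component:
  "p < 2 \<Longrightarrow> card (unit_classes (component p) u) = card (component p)"
  using finite_component card_component_le
  by (rule card_unit_classes) (auto simp: component_def unit)

lemma uniformizer_dvd_coordinate:
  assumes "\<pi>\<^sup>2 dvd form z" "i \<in> I"
  shows "\<pi> dvd z i"
proof -
  have "\<pi> dvd form z"
    using assms(1) by (metis dvd_mult_left power2_eq_square)
  then have comp_0: "\<pi> dvd diag_form (component 0) u z"
    unfolding form_components by (simp add: dvd_add_left_iff)
  then have "\<pi>\<^sup>2 dvd diag_form (component 0) u z"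
    by (intro residually_anisotropic_dvd_square residually_anisotropic_component) simp
  then have "\<pi>\<^sup>2 dvd \<pi> * diag_form (component 1) u z"
    using assms(1) unfolding form_components by (simp add: dvd_add_right_iff)
  then have comp_1: "\<pi> dvd diag_form (component 1) u z"
    using uniformizer_nonzero by (simp add: power2_eq_square)
  have "i \<in> component 0 \<or> i \<in> component 1"
    using assms(2) exponent_less_2[of i] by (auto simp: component_def)
  then show ?thesis
    using residually_anisotropicD[OF residually_anisotropic_component comp_0]
      residually_anisotropicD[OF residually_anisotropic_component comp_1] by auto
qed

lemma uniformizer_power_dvd_coordinate:
  assumes "\<pi> ^ (2 * k) dvd form z" "i \<in> I"
  shows "\<pi> ^ k dvd z i"
  using assms
proof (induction k arbitrary: z)
  case (Suc k)
  have power: "\<pi> ^ (2 * Suc k) = \<pi>\<^sup>2 * \<pi> ^ (2 * k)"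
    by (simp add: power2_eq_square)
  then have "\<pi>\<^sup>2 dvd form z"
    using Suc.prems(1) by (metis dvd_mult_left)
  then have "\<And>i. i \<in> I \<Longrightarrow> \<pi> dvd z i"
    by (rule uniformizer_dvd_coordinate)
  then obtain y where y: "\<And>i. i \<in> I \<Longrightarrow> z i = \<pi> * y i" "form z = \<pi>\<^sup>2 * form y"
    by (rule diag_form_common_factor[where c = "\<lambda>i. u i * \<pi> ^ e i"]) blast+
  then have "\<pi> ^ (2 * k) dvd form y"
    using Suc.prems(1) uniformizer_nonzero unfolding power by simp
  then have "\<pi> ^ k dvd y i"
    using Suc.prems(2) by (rule Suc.IH)
  then show ?case
    using y(1)[OF Suc.prems(2)] by simp
qed simp

lemma form_anisotropic: "diag_anisotropic I (\<lambda>i. u i * \<pi> ^ e i)"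
  unfolding diag_anisotropic_def
proof (intro allI impI ballI)
  fix z i assume form_z: "form z = 0" and i: "i \<in> I"
  have "\<pi> ^ k dvd z i" for k
    by (rule uniformizer_power_dvd_coordinate[OF _ i]) (simp add: form_z)
  then show "z i = 0"
    by (rule eq_0_if_all_powers_dvd)
qed

lemma dvd_coordinate:
  assumes "s \<noteq> 0" "s\<^sup>2 dvd form z" "i \<in> I"
  shows "s dvd z i"
proof -
  obtain k v where s: "s = v * \<pi> ^ k" "\<not> \<pi> dvd v"
    by (rule uniformizer_factorization[OF assms(1)])
  have "\<pi> ^ (2 * k) dvd s\<^sup>2"
    by (simp add: s power_mult_distrib power_even_eq)
  then have "\<pi> ^ k dvd z i"
    using assms(2,3) dvd_trans uniformizer_power_dvd_coordinate by blast
  moreover have "v dvd 1"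
    using s(2) by (simp add: not_uniformizer_dvd_iff_unit)
  ultimately show ?thesis
    using mult_dvd_mono[of v 1 "\<pi> ^ k" "z i"] by (simp add: s)
qed

lemma form_descent:
  assumes "s \<noteq> 0" "s\<^sup>2 * x = form z"
  shows "x \<in> range form"
proof -
  have "s\<^sup>2 dvd form z"
    using assms(2) by (metis dvd_triv_left)
  then have "\<And>i. i \<in> I \<Longrightarrow> s dvd z i"
    by (rule dvd_coordinate[OF assms(1)])
  then obtain y where "form z = s\<^sup>2 * form y"
    by (rule diag_form_common_factor[where c = "\<lambda>i. u i * \<pi> ^ e i"]) blast+
  with assms show ?thesis
    by simp
qed

lemma to_fract_in_range_form_iff:
  "to_fract x \<in> range (diag_form I (\<lambda>i. to_fract (u i * \<pi> ^ e i))) \<longleftrightarrow> x \<in> range form"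
  unfolding to_fract_in_range_diag_form_iff[OF finite_I]
proof
  show "x \<in> range form" if "\<exists>s z. s \<noteq> 0 \<and> s\<^sup>2 * x = form z"
    using that form_descent by blast
  show "\<exists>s z. s \<noteq> 0 \<and> s\<^sup>2 * x = form z" if "x \<in> range form"
    using that by (intro exI[of _ 1]) auto
qed

lemma unit_part_cong_component:
  assumes "w * \<pi> ^ p = form z" "p < 2"
  shows "\<pi> dvd w - diag_form (component p) u z"
proof (cases "p = 0")
  case True
  then have "w - diag_form (component p) u z = \<pi> * diag_form (component 1) u z"
    using assms(1) by (simp add: form_components)
  then show ?thesis
    by simp
next
  case False
  then have p: "p = 1"
    using assms(2) by simp
  then have comp_0: "diag_form (component 0) u z = \<pi> * (w - diag_form (component 1) u z)"
    using assms(1) by (simp add: form_components algebra_simps)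
  then have "\<pi>\<^sup>2 dvd diag_form (component 0) u z"
    by (intro residually_anisotropic_dvd_square residually_anisotropic_component) simp_all
  then show ?thesis
    using uniformizer_nonzero p by (simp add: comp_0 power2_eq_square)
qed

lemma form_value_in_square_class:
  assumes "x \<in> range form" "x \<noteq> 0"
  obtains p b where "p < 2" "b \<in> unit_classes (component p) u" "x \<in> square_class p b"
proof -
  obtain z where z: "x = form z"
    using assms(1) by blast
  obtain m w where w: "x = w * \<pi> ^ m" "\<not> \<pi> dvd w"
    by (rule uniformizer_factorization[OF assms(2)])
  define k p where "k = m div 2" and "p = m mod 2"
  then have m: "m = 2 * k + p" and p: "p < 2"
    by simp_all
  have "(\<pi> ^ k)\<^sup>2 * (w * \<pi> ^ p) = form z"
    unfolding z[symmetric] w(1) m by (simp only: power_add power_even_eq) (simp only: mult_ac)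
  then obtain y where y: "w * \<pi> ^ p = form y"
    using form_descent[of "\<pi> ^ k"] uniformizer_nonzero by auto
  note cong = unit_part_cong_component[OF y p]
  have "residue_square w \<in> unit_classes (component p) u"
    unfolding unit_classes_def
    using w(2) uniformizer_dvd_cong[OF cong] residue_square_cong[OF cong] by blast
  moreover have "x \<in> square_class p (residue_square w)"
    unfolding square_class_def sphere_class_def using w m by blast
  ultimately show thesis
    using p that by blast
qed

lemma square_class_subset_form_values:
  assumes "b \<in> unit_classes (component p) u"
  shows "square_class p b \<subseteq> range form"
proof
  fix x assume "x \<in> square_class p b"
  then obtain k w where w: "x = w * \<pi> ^ (2 * k + p)" "\<not> \<pi> dvd w" "residue_square w = b"
    unfolding square_class_def sphere_class_def by blast
  obtain z where z: "\<not> \<pi> dvd diag_form (component p) u z"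
    "b = residue_square (diag_form (component p) u z)"
    using assms unfolding unit_classes_def by blast
  then obtain s where "w = diag_form (component p) u z * s\<^sup>2"
    using w same_class_units_differ_by_square by metis
  then have "x = (\<pi> ^ k * s)\<^sup>2 * (\<pi> ^ p * diag_form (component p) u z)"
    unfolding w(1) by (simp only: power_mult_distrib power_add power_even_eq) (simp only: mult_ac)
  also have "\<dots> = \<pi> ^ p * diag_form (component p) u (\<lambda>i. \<pi> ^ k * s * z i)"
    by (simp add: diag_form_scale mult.left_commute)
  also have "\<dots> = form (\<lambda>i. if i \<in> component p then \<pi> ^ k * s * z i else 0)"
    by (simp only: diag_form_extend_by_zero[OF finite_I component_subset] diag_form_component)
  finally show "x \<in> range form"
    by blast
qed

theorem form_values:
  "range form - {0} = (\<Union>(p, b) \<in> (SIGMA p:{..<2}. unit_classes (component p) u). square_class p b)"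
proof (intro equalityI subsetI)
  fix x assume "x \<in> range form - {0}"
  then obtain p b where "p < 2" "b \<in> unit_classes (component p) u" "x \<in> square_class p b"
    using form_value_in_square_class[of x] by blast
  then show "x \<in> (\<Union>(p, b) \<in> (SIGMA p:{..<2}. unit_classes (component p) u). square_class p b)"
    by blast
next
  fix x assume "x \<in> (\<Union>(p, b) \<in> (SIGMA p:{..<2}. unit_classes (component p) u). square_class p b)"
  then show "x \<in> range form - {0}"
    using square_class_subset_form_values zero_notin_square_class by blast
qed

end

context odd_complete_dvr
begin

lemma normalised_diagonal_formI:
  assumes "finite I" and unit: "\<And>i. i \<in> I \<Longrightarrow> \<not> \<pi> dvd u i"
    and "\<And>i. i \<in> I \<Longrightarrow> e i < 2"
    and aniso: "diag_anisotropic I (\<lambda>i. u i * \<pi> ^ e i)"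
  shows "normalised_diagonal_form \<mm> I u e"
proof unfold_locales
  fix p
  let ?J = "{i \<in> I. e i = p}"
  have "diag_anisotropic ?J (\<lambda>i. u i * \<pi> ^ e i)"
    using aniso assms(1) by (rule diag_anisotropic_subset) blast
  moreover have "diag_form ?J (\<lambda>i. u i * \<pi> ^ e i) z = \<pi> ^ p * diag_form ?J u z" for z
    unfolding diag_form_def sum_distrib_left by (intro sum.cong) auto
  ultimately have "diag_anisotropic ?J u"
    by (simp add: diag_anisotropic_def uniformizer_nonzero)
  then show "residually_anisotropic ?J u"
    using assms(1) unit by (intro diag_anisotropic_imp_residually_anisotropic) auto
qed (use assms in auto)

lemma anisotropic_normalised_diagonal_form:
  assumes "anisotropic n a"
  obtains u e where "normalised_diagonal_form \<mm> {..<n} u e"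
    "range (qf_frac n a) = range (diag_form {..<n} (\<lambda>i. to_fract (u i * \<pi> ^ e i)))"
proof -
  have "\<forall>i<n. x i = 0" if "qf n (\<lambda>i j. Fract (a i j) 1) x = 0" for x
    using assms that by (simp add: anisotropic_def qf_frac_def)
  then obtain c where c: "range (qf_frac n a) = range (diag_form {..<n} c)"
    "diag_anisotropic {..<n} c"
    unfolding qf_frac_def by (rule anisotropic_range_diag_form[OF two_fract_neq_0]) blast+
  have "\<exists>v e t. \<not> \<pi> dvd v \<and> e < (2::nat) \<and> t \<noteq> 0 \<and> c i = to_fract (v * \<pi> ^ e) * t\<^sup>2"
    if "i \<in> {..<n}" for i
    by (rule fract_eq_unit_times_square[OF diag_anisotropic_nonzero[OF c(2) that]]) blast
  then obtain u e t where
    u: "\<And>i. i \<in> {..<n} \<Longrightarrow> \<not> \<pi> dvd u i" and e: "\<And>i. i \<in> {..<n} \<Longrightarrow> e i < (2::nat)"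
    and t: "\<And>i. i \<in> {..<n} \<Longrightarrow> t i \<noteq> 0"
    and c_eq: "\<And>i. i \<in> {..<n} \<Longrightarrow> c i = to_fract (u i * \<pi> ^ e i) * (t i)\<^sup>2"
    by metis
  let ?d = "\<lambda>i. to_fract (u i * \<pi> ^ e i)"
  have form_c: "diag_form {..<n} c = diag_form {..<n} (\<lambda>i. ?d i * (t i)\<^sup>2)"
    using c_eq by (intro ext diag_form_cong) auto
  then have range: "range (qf_frac n a) = range (diag_form {..<n} ?d)"
    unfolding c(1) by (simp only: range_diag_form_absorb_squares[OF t])
  have "diag_anisotropic {..<n} (\<lambda>i. ?d i * (t i)\<^sup>2)"
    using c(2) unfolding diag_anisotropic_def form_c .
  with t have "diag_anisotropic {..<n} ?d"
    by (rule diag_anisotropic_absorb_squares)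
  then have "diag_anisotropic {..<n} (\<lambda>i. u i * \<pi> ^ e i)"
    by (subst (asm) diag_anisotropic_to_fract_iff) simp_all
  with finite_lessThan u e have "normalised_diagonal_form \<mm> {..<n} u e"
    by (rule normalised_diagonal_formI)
  then show thesis
    using range by (rule that)
qed

end

section \<open>Measure of the square classes\<close>

locale finite_residue_dvr_haar = finite_residue_dvr \<mm> for \<mm> :: "'r::idom set" +
  fixes \<mu> :: "'r measure"
  assumes haar: "normalised_haar_measure \<mm> \<mu>"
begin

sublocale finite_measure \<mu>
  by standard (use haar in \<open>simp add: normalised_haar_measure_def\<close>)

definition coset :: "nat \<Rightarrow> 'r \<Rightarrow> 'r set" where
  "coset k x = {y. \<pi> ^ k dvd y - x}"

lemma coset_sets [simp]: "coset k x \<in> sets \<mu>"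
proof -
  have "adic_open \<mm> (coset k x)"
    unfolding adic_open_def ideal_power_maximal
  proof (intro ballI exI[of _ k] allI impI)
    fix z y assume "z \<in> coset k x" "y - z \<in> {x. \<pi> ^ k dvd x}"
    then have "\<pi> ^ k dvd (y - z) + (z - x)"
      unfolding coset_def by (intro dvd_add) simp_all
    then show "y \<in> coset k x"
      by (simp add: coset_def)
  qed
  then show ?thesis
    using haar by (simp add: normalised_haar_measure_def sigma_sets.Basic)
qed

lemma measure_coset_translate: "measure \<mu> (coset k x) = measure \<mu> (coset k 0)"
proof -
  have "coset k x = (\<lambda>y. x + y) ` coset k 0"
  proof (intro equalityI subsetI)
    fix y assume "y \<in> coset k x"
    then show "y \<in> (\<lambda>y. x + y) ` coset k 0"
      by (intro image_eqI[of _ _ "y - x"]) (auto simp: coset_def)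
  qed (auto simp: coset_def)
  then show ?thesis
    using haar coset_sets[of k 0] unfolding normalised_haar_measure_def measure_def by metis
qed

lemma coset_eq_Union: "coset k x = (\<Union>t\<in>residue_reps. coset (Suc k) (x + \<pi> ^ k * t))"
proof (intro equalityI subsetI)
  fix y assume "y \<in> coset k x"
  then obtain c where c: "y - x = \<pi> ^ k * c"
    unfolding coset_def by auto
  have "y - (x + \<pi> ^ k * residue_rep c) = \<pi> ^ k * (c - residue_rep c)"
    using c by (simp add: algebra_simps)
  then have "y \<in> coset (Suc k) (x + \<pi> ^ k * residue_rep c)"
    using uniformizer_dvd_diff_residue_rep
    by (simp only: coset_def mem_Collect_eq uniformizer_power_Suc_dvd_iff)
  then show "y \<in> (\<Union>t\<in>residue_reps. coset (Suc k) (x + \<pi> ^ k * t))"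
    using residue_rep_in_residue_reps by blast
next
  fix y assume "y \<in> (\<Union>t\<in>residue_reps. coset (Suc k) (x + \<pi> ^ k * t))"
  then obtain t where "\<pi> ^ Suc k dvd y - (x + \<pi> ^ k * t)"
    unfolding coset_def by auto
  then have "\<pi> ^ k dvd y - (x + \<pi> ^ k * t)"
    by (rule power_le_dvd) simp
  then have "\<pi> ^ k dvd (y - (x + \<pi> ^ k * t)) + \<pi> ^ k * t"
    by (rule dvd_add) simp
  then show "y \<in> coset k x"
    by (simp add: coset_def)
qed

lemma disjoint_family_cosets:
  "disjoint_family_on (\<lambda>t. coset (Suc k) (x + \<pi> ^ k * t)) residue_reps"
  unfolding disjoint_family_on_def
proof (intro ballI impI, rule ccontr)
  fix s t assume st: "s \<in> residue_reps" "t \<in> residue_reps" "s \<noteq> t"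
    and "coset (Suc k) (x + \<pi> ^ k * s) \<inter> coset (Suc k) (x + \<pi> ^ k * t) \<noteq> {}"
  then obtain y where "\<pi> ^ Suc k dvd y - (x + \<pi> ^ k * t)" "\<pi> ^ Suc k dvd y - (x + \<pi> ^ k * s)"
    unfolding coset_def by auto
  from dvd_diff[OF this] have "\<pi> ^ Suc k dvd \<pi> ^ k * (s - t)"
    by (simp add: algebra_simps)
  with st show False
    by (simp only: uniformizer_power_Suc_dvd_iff residue_reps_eq_iff)
qed

lemma measure_coset_Union:
  assumes "S \<subseteq> residue_reps"
  shows "measure \<mu> (\<Union>t\<in>S. coset (Suc k) (x + \<pi> ^ k * t)) = card S * measure \<mu> (coset (Suc k) 0)"
proof -
  have "measure \<mu> (\<Union>t\<in>S. coset (Suc k) (x + \<pi> ^ k * t)) =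
      (\<Sum>t\<in>S. measure \<mu> (coset (Suc k) (x + \<pi> ^ k * t)))"
    using finite_subset[OF assms] disjoint_family_on_mono[OF assms disjoint_family_cosets]
    by (intro finite_measure_finite_Union) auto
  also have "\<dots> = (\<Sum>t\<in>S. measure \<mu> (coset (Suc k) 0))"
    by (rule sum.cong[OF refl]) (rule measure_coset_translate)
  finally show ?thesis
    by simp
qed

lemma measure_coset: "measure \<mu> (coset k 0) = 1 / real q ^ k"
proof (induction k)
  case 0
  then show ?case
    using haar by (simp add: coset_def measure_def normalised_haar_measure_def)
next
  case (Suc k)
  have "measure \<mu> (coset k 0) = q * measure \<mu> (coset (Suc k) 0)"
    using measure_coset_Union[OF order_refl, of k 0] coset_eq_Union[of k 0]
    by (simp add: card_residue_reps)
  then show ?case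
    using Suc card_residue_field_pos by (simp add: field_simps)
qed

lemma sphere_class_eq_Union: "sphere_class k b = (\<Union>t\<in>class_reps b. coset (Suc k) (\<pi> ^ k * t))"
proof (intro equalityI subsetI)
  fix y assume "y \<in> sphere_class k b"
  then obtain w where w: "y = w * \<pi> ^ k" "\<not> \<pi> dvd w" "residue_square w = b"
    unfolding sphere_class_def by auto
  have "y - \<pi> ^ k * residue_rep w = \<pi> ^ k * (w - residue_rep w)"
    by (simp add: w(1) algebra_simps)
  then have "y \<in> coset (Suc k) (\<pi> ^ k * residue_rep w)"
    using uniformizer_dvd_diff_residue_rep
    by (simp only: coset_def mem_Collect_eq uniformizer_power_Suc_dvd_iff)
  moreover have "residue_rep w \<in> class_reps b"
    using w(2,3) by (simp add: residue_rep_in_class_reps_iff)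
  ultimately show "y \<in> (\<Union>t\<in>class_reps b. coset (Suc k) (\<pi> ^ k * t))"
    by blast
next
  fix y assume "y \<in> (\<Union>t\<in>class_reps b. coset (Suc k) (\<pi> ^ k * t))"
  then obtain t where t: "\<not> \<pi> dvd t" "residue_square t = b" "\<pi> ^ Suc k dvd y - \<pi> ^ k * t"
    unfolding coset_def class_reps_def unit_reps_def by auto
  then obtain c where c: "y - \<pi> ^ k * t = \<pi> ^ Suc k * c"
    by (auto elim: dvdE)
  have "y = (y - \<pi> ^ k * t) + \<pi> ^ k * t"
    by simp
  also have "\<dots> = (t + \<pi> * c) * \<pi> ^ k"
    unfolding c by (simp add: algebra_simps)
  finally have "y = (t + \<pi> * c) * \<pi> ^ k" .
  moreover have cong: "\<pi> dvd (t + \<pi> * c) - t"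
    by simp
  have "\<not> \<pi> dvd t + \<pi> * c" "residue_square (t + \<pi> * c) = b"
    using uniformizer_dvd_cong[OF cong] residue_square_cong[OF cong] t by simp_all
  ultimately show "y \<in> sphere_class k b"
    unfolding sphere_class_def by blast
qed

lemma sphere_class_sets: "sphere_class k b \<in> sets \<mu>"
  unfolding sphere_class_eq_Union by (intro sets.finite_UN) auto

lemma square_class_sets: "square_class p b \<in> sets \<mu>"
  unfolding square_class_def using sphere_class_sets by (intro sets.countable_UN) auto

end

locale odd_residue_dvr_haar = odd_residue_dvr \<mm> + finite_residue_dvr_haar \<mm> \<mu>
  for \<mm> :: "'r::idom set" and \<mu> :: "'r measure"
begin

lemma measure_sphere_class: "measure \<mu> (sphere_class k b) = (real q - 1) / (2 * real q ^ Suc k)"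
proof -
  have "measure \<mu> (sphere_class k b) = card (class_reps b) * (1 / real q ^ Suc k)"
    using measure_coset_Union[OF class_reps_subset, of k 0] measure_coset[of "Suc k"]
    by (simp add: sphere_class_eq_Union)
  moreover have "real (card (class_reps b)) = (real q - 1) / 2"
    using arg_cong[OF card_residue_field_eq[of b], of real] by simp
  ultimately show ?thesis
    by simp
qed

lemma measure_square_class:
  "measure \<mu> (square_class p b) = real q / (real q ^ p * (2 * (real q + 1)))"
proof -
  have q: "real q > 1"
    using card_residue_field_gt_1 by simp
  have "(\<lambda>k. measure \<mu> (sphere_class (2 * k + p) b)) sums measure \<mu> (square_class p b)"
    unfolding square_class_def
  proof (rule finite_measure_UNION)
    show "disjoint_family (\<lambda>k. sphere_class (2 * k + p) b)"
      unfolding disjoint_family_on_def using sphere_class_disjoint(1) by fastforce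
  qed (use sphere_class_sets in auto)
  moreover have "measure \<mu> (sphere_class (2 * k + p) b) =
      (real q - 1) / (2 * real q ^ Suc p) * (1 / (real q)\<^sup>2) ^ k" for k
  proof -
    have "Suc (2 * k + p) = Suc p + 2 * k"
      by simp
    then have "real q ^ Suc (2 * k + p) = real q ^ Suc p * ((real q)\<^sup>2) ^ k"
      by (simp only: power_add power_mult)
    then show ?thesis
      unfolding measure_sphere_class by (simp only: power_divide power_one) simp
  qed
  moreover have "(\<lambda>k. (real q - 1) / (2 * real q ^ Suc p) * (1 / (real q)\<^sup>2) ^ k) sums
      ((real q - 1) / (2 * real q ^ Suc p) * (1 / (1 - 1 / (real q)\<^sup>2)))"
    using q by (intro sums_mult geometric_sums) (simp add: power2_eq_square less_1_mult)
  ultimately have "measure \<mu> (square_class p b) =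
      (real q - 1) / (2 * real q ^ Suc p) * (1 / (1 - 1 / (real q)\<^sup>2))"
    using sums_unique2 by simp
  also have "1 - 1 / (real q)\<^sup>2 = (real q - 1) * (real q + 1) / (real q)\<^sup>2"
    using q by (simp add: field_simps power2_eq_square)
  also have "(real q - 1) / (2 * real q ^ Suc p) *
      (1 / ((real q - 1) * (real q + 1) / (real q)\<^sup>2)) =
      real q / (real q ^ p * (2 * (real q + 1)))"
    using q by (simp add: divide_simps) (simp add: power2_eq_square)
  finally show ?thesis .
qed

end

section \<open>Densities of anisotropic ADC forms\<close>

locale odd_complete_dvr_haar = odd_complete_dvr \<mm> + odd_residue_dvr_haar \<mm> \<mu>
  for \<mm> :: "'r::idom set" and \<mu> :: "'r measure"

locale normalised_diagonal_form_haar = normalised_diagonal_form \<mm> I u e + odd_complete_dvr_haar \<mm> \<mu>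
  for \<mm> :: "'r::idom set" and I :: "'i set" and u :: "'i \<Rightarrow> 'r" and e :: "'i \<Rightarrow> nat"
    and \<mu> :: "'r measure"
begin

lemma measure_form_values:
  "measure \<mu> (range form - {0}) =
     (real (card (component 0)) * real q + real (card (component 1))) / (2 * (real q + 1))"
proof -
  let ?classes = "SIGMA p:{..<2}. unit_classes (component p) u"
  have finite_classes: "finite (unit_classes (component p) u)" for p
    by simp
  have "measure \<mu> (range form - {0}) = (\<Sum>(p, b)\<in>?classes. measure \<mu> (square_class p b))"
    unfolding form_values case_prod_unfold
  proof (rule finite_measure_finite_Union)
    show "disjoint_family_on (\<lambda>x. square_class (fst x) (snd x)) ?classes"
      using disjoint_family_square_classes unfolding case_prod_unfold
      by (rule disjoint_family_on_mono[rotated]) auto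
  qed (use finite_classes square_class_sets in auto)
  also have "\<dots> = (\<Sum>p<2. card (unit_classes (component p) u) *
      (real q / (real q ^ p * (2 * (real q + 1)))))"
    using finite_classes by (simp add: sum.Sigma[symmetric] measure_square_class)
  also have "\<dots> = (\<Sum>p<2. card (component p) * (real q / (real q ^ p * (2 * (real q + 1)))))"
    by (rule sum.cong) (simp_all add: card_unit_classes_component)
  finally show ?thesis
    using card_residue_field_gt_1 by (simp add: numeral_2_eq_2 add_divide_distrib)
qed

end

context odd_complete_dvr_haar
begin

lemma ADC_density:
  assumes "anisotropic n a" "ADC n a"
  obtains r s where "r \<le> 2" "s \<le> 2" "r + s = n"
    "qf_density \<mu> n a = (real r * real q + real s) / (2 * (real q + 1))"
proof -
  obtain u e where normalised: "normalised_diagonal_form \<mm> {..<n} u e"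
    and range: "range (qf_frac n a) = range (diag_form {..<n} (\<lambda>i. to_fract (u i * \<pi> ^ e i)))"
    by (rule anisotropic_normalised_diagonal_form[OF assms(1)])
  interpret normalised_diagonal_form \<mm> "{..<n}" u e
    by (rule normalised)
  interpret normalised_diagonal_form_haar \<mm> "{..<n}" u e \<mu> ..
  have "range (qf n a) = range form"
    using assms(2) unfolding ADC_iff_range range to_fract_in_range_form_iff by simp
  then have "qf_density \<mu> n a =
      (real (card (component 0)) * real q + real (card (component 1))) / (2 * (real q + 1))"
    unfolding qf_density_def nonzero_values_def by (simp only: measure_form_values)
  then show thesis
    using card_component_le card_component_sum by (intro that) auto
qed

text \<open>The witness is \<open>\<langle>1, -\<epsilon>\<rangle> \<bottom> \<pi> \<langle>1, -\<epsilon>\<rangle>\<close> with the two summands truncated to \<open>r\<close> and \<open>s\<close> variables,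
  for a nonsquare unit \<open>\<epsilon>\<close>.\<close>

lemma ex_normalised_diagonal_form_of_ranks:
  fixes r s :: nat
  assumes "r \<le> 2" "s \<le> 2"
  obtains u e where "normalised_diagonal_form \<mm> {..<r + s} u e"
    "{i \<in> {..<r + s}. e i = 0} = {..<r}" "{i \<in> {..<r + s}. e i = 1} = {r..<r + s}"
proof -
  obtain \<epsilon> where \<epsilon>: "\<not> \<pi> dvd \<epsilon>" "\<not> residue_square \<epsilon>"
    using ex_unit_in_class[of False] by blast
  define u where "u = (\<lambda>i. if i = 0 \<or> i = r then 1 else - \<epsilon>)"
  define e :: "nat \<Rightarrow> nat" where "e = (\<lambda>i. if i < r then 0 else 1)"
  have components: "{i \<in> {..<r + s}. e i = 0} = {..<r}" "{i \<in> {..<r + s}. e i = 1} = {r..<r + s}"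
    by (auto simp: e_def)
  have "residually_anisotropic {..<r} u" "residually_anisotropic {r..<r + s} u"
    using assms residually_anisotropic_norm_form[OF \<epsilon>, of r 0 u]
      residually_anisotropic_norm_form[OF \<epsilon>, of s r u]
    by (simp_all add: u_def atLeast0LessThan)
  then have "residually_anisotropic {i \<in> {..<r + s}. e i = p} u" if "p < 2" for p
    using that unfolding less_2_cases_iff One_nat_def[symmetric]
    by (elim disjE) (simp_all only: components)
  moreover have "\<not> \<pi> dvd u i" "e i < 2" for i
    using \<epsilon>(1) not_uniformizer_dvd_1 by (simp_all add: u_def e_def)
  ultimately have "normalised_diagonal_form \<mm> {..<r + s} u e"
    by unfold_locales auto
  then show thesis
    using components by (rule that)
qed

lemma ADC_density_occurs:
  assumes "r \<le> 2" "s \<le> 2"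
  obtains a where "nondegenerate (r + s) a" "anisotropic (r + s) a" "ADC (r + s) a"
    "qf_density \<mu> (r + s) a = (real r * real q + real s) / (2 * (real q + 1))"
proof -
  let ?n = "r + s"
  obtain u e where normalised: "normalised_diagonal_form \<mm> {..<?n} u e"
    and components: "{i \<in> {..<?n}. e i = 0} = {..<r}" "{i \<in> {..<?n}. e i = 1} = {r..<?n}"
    by (rule ex_normalised_diagonal_form_of_ranks[OF assms])
  interpret normalised_diagonal_form \<mm> "{..<?n}" u e
    by (rule normalised)
  interpret normalised_diagonal_form_haar \<mm> "{..<?n}" u e \<mu> ..
  define a where "a = (\<lambda>i j. if i = j then u i * \<pi> ^ e i else 0)"
  have qf: "qf ?n a = form"
    unfolding a_def by (rule ext) (rule qf_diagonal)
  have "(\<lambda>i j. Fract (a i j) 1) = (\<lambda>i j. if i = j then to_fract (u i * \<pi> ^ e i) else 0)"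
    by (simp add: a_def fun_eq_iff to_fract_def[symmetric])
  then have qf_frac: "qf_frac ?n a = diag_form {..<?n} (\<lambda>i. to_fract (u i * \<pi> ^ e i))"
    unfolding qf_frac_def by (simp only:) (rule ext, rule qf_diagonal)
  have "diag_anisotropic {..<?n} (\<lambda>i. to_fract (u i * \<pi> ^ e i))"
    using form_anisotropic by (simp only: diag_anisotropic_to_fract_iff finite_lessThan)
  then have aniso: "anisotropic ?n a"
    by (simp add: anisotropic_def diag_anisotropic_def qf_frac)
  moreover have "nondegenerate ?n a"
    using two_fract_neq_0 aniso by (rule anisotropic_imp_nondegenerate)
  moreover have "ADC ?n a"
    unfolding ADC_iff_range qf qf_frac to_fract_in_range_form_iff by simp
  moreover have "qf_density \<mu> ?n a = (real r * real q + real s) / (2 * (real q + 1))"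
    unfolding qf_density_def nonzero_values_def qf measure_form_values component_def components
    by simp
  ultimately show thesis
    by (intro that)
qed

definition ADC_densities :: "nat \<Rightarrow> real set" where
  "ADC_densities n = {qf_density \<mu> n a | a. nondegenerate n a \<and> anisotropic n a \<and> ADC n a}"

theorem ADC_densities_eq:
  "ADC_densities n =
     (\<lambda>(r, s). (real r * real q + real s) / (2 * (real q + 1))) `
       {(r, s). r \<le> 2 \<and> s \<le> 2 \<and> r + s = n}"
  (is "_ = ?density ` ?ranks")
proof (intro equalityI subsetI)
  fix d assume "d \<in> ADC_densities n"
  then obtain a where a: "anisotropic n a" "ADC n a" "d = qf_density \<mu> n a"
    unfolding ADC_densities_def by blast
  obtain r s where "r \<le> 2" "s \<le> 2" "r + s = n"
    "d = (real r * real q + real s) / (2 * (real q + 1))"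
    unfolding a(3) by (rule ADC_density[OF a(1,2)])
  then show "d \<in> ?density ` ?ranks"
    by (intro image_eqI[of _ _ "(r, s)"]) auto
next
  fix d assume "d \<in> ?density ` ?ranks"
  then obtain r s where rs: "r \<le> 2" "s \<le> 2" "n = r + s"
    "d = (real r * real q + real s) / (2 * (real q + 1))"
    by auto
  obtain a where "nondegenerate n a" "anisotropic n a" "ADC n a" "qf_density \<mu> n a = d"
    unfolding rs(3,4) by (rule ADC_density_occurs[OF rs(1,2)])
  then show "d \<in> ADC_densities n"
    unfolding ADC_densities_def by blast
qed

lemma ADC_densities_binary:
  "ADC_densities 2 = {real q / (real q + 1), 1 / 2, 1 / (real q + 1)}"
proof -
  have "{(r, s). r \<le> 2 \<and> s \<le> 2 \<and> r + s = (2::nat)} = {(2, 0), (1, 1), (0, 2)}"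
    by auto
  moreover have "(real 2 * real q + real 0) / (2 * (real q + 1)) = real q / (real q + 1)"
    "(real 1 * real q + real 1) / (2 * (real q + 1)) = 1 / 2"
    "(real 0 * real q + real 2) / (2 * (real q + 1)) = 1 / (real q + 1)"
    using card_residue_field_gt_1 by (simp_all add: divide_simps)
  ultimately show ?thesis
    by (simp only: ADC_densities_eq image_insert image_empty case_prod_conv)
qed

lemma ADC_densities_ternary:
  "ADC_densities 3 = {(real q + 2) / (2 * real q + 2), (2 * real q + 1) / (2 * real q + 2)}"
proof -
  have "{(r, s). r \<le> 2 \<and> s \<le> 2 \<and> r + s = (3::nat)} = {(1, 2), (2, 1)}"
    by auto
  then show ?thesis
    by (simp add: ADC_densities_eq algebra_simps)
qed

lemma ADC_densities_ge_4:
  assumes "n \<ge> 4"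
  shows "ADC_densities n \<subseteq> {1}"
proof -
  have "{(r, s). r \<le> 2 \<and> s \<le> 2 \<and> r + s = n} \<subseteq> {(2, 2)}"
    using assms by auto
  then have "ADC_densities n \<subseteq>
      (\<lambda>(r, s). (real r * real q + real s) / (2 * (real q + 1))) ` {(2, 2)}"
    unfolding ADC_densities_eq by (rule image_mono)
  then show ?thesis
    by (simp add: add_divide_distrib[symmetric] field_simps)
qed

end

theorem theorem2p5:
  fixes \<mm> :: "'r::idom set" and q :: nat and \<mu> :: "'r measure"
  assumes "complete_discrete_valuation_ring \<mm>"
    and "finite (residue_field \<mm>)" and "card (residue_field \<mm>) = q" and "odd q"
    and "CHAR('r fract) \<noteq> 2"
    and "normalised_haar_measure \<mm> \<mu>"
  shows
    "((\<forall>a :: nat \<Rightarrow> nat \<Rightarrow> 'r. nondegenerate 2 a \<and> anisotropic 2 a \<and> ADC 2 a \<longrightarrow>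
         qf_density \<mu> 2 a \<in> {real q / (real q + 1), 1 / 2, 1 / (real q + 1)}) \<and>
      (\<forall>d \<in> {real q / (real q + 1), 1 / 2, 1 / (real q + 1)}.
         \<exists>a :: nat \<Rightarrow> nat \<Rightarrow> 'r. nondegenerate 2 a \<and> anisotropic 2 a \<and> ADC 2 a \<and>
           qf_density \<mu> 2 a = d)) \<and>
     ((\<forall>a :: nat \<Rightarrow> nat \<Rightarrow> 'r. nondegenerate 3 a \<and> anisotropic 3 a \<and> ADC 3 a \<longrightarrow>
         qf_density \<mu> 3 a \<in> {(real q + 2) / (2 * real q + 2), (2 * real q + 1) / (2 * real q + 2)}) \<and>
      (\<forall>d \<in> {(real q + 2) / (2 * real q + 2), (2 * real q + 1) / (2 * real q + 2)}.
         \<exists>a :: nat \<Rightarrow> nat \<Rightarrow> 'r. nondegenerate 3 a \<and> anisotropic 3 a \<and> ADC 3 a \<and>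
           qf_density \<mu> 3 a = d)) \<and>
     (\<forall>n \<ge> 4. \<forall>a :: nat \<Rightarrow> nat \<Rightarrow> 'r. nondegenerate n a \<and> anisotropic n a \<and> ADC n a \<longrightarrow>
         qf_density \<mu> n a = 1)"
proof -
  interpret complete_discrete_valuation_ring \<mm>
    by fact
  interpret odd_complete_dvr_haar \<mm> \<mu>
    by unfold_locales (use assms in simp_all)
  have densities: "(\<forall>a. nondegenerate n a \<and> anisotropic n a \<and> ADC n a \<longrightarrow> qf_density \<mu> n a \<in> S) \<and>
      (\<forall>d\<in>S. \<exists>a. nondegenerate n a \<and> anisotropic n a \<and> ADC n a \<and> qf_density \<mu> n a = d)"
    if "ADC_densities n = S" for n S
    using that unfolding ADC_densities_def by blast
  have "\<forall>n\<ge>4. \<forall>a. nondegenerate n a \<and> anisotropic n a \<and> ADC n a \<longrightarrow> qf_density \<mu> n a = 1"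
    using ADC_densities_ge_4 unfolding ADC_densities_def by blast
  with densities[OF ADC_densities_binary] densities[OF ADC_densities_ternary]
  show ?thesis
    unfolding assms(3) by (rule conjI[OF _ conjI])
qed

end
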